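(* Let $U:\mathbb{R}_+\to\mathbb{R}$ be a continuously differentiable function vanishing at infinity, with $U(0)=0$, such that $U\in L^2(\lambda)$, where $\lambda$ is Lebesgue measure on $\mathbb{R}_+=[0,\infty)$, and such that its derivative $U'$ takes values in $(-1,+\infty)$. Let $\mu_\lambda$ be the Poisson measure of intensity $\lambda$ on the configuration space $\Gamma_{\mathbb{R}_+}$ and let $\nu$ be the Poisson measure on $\Gamma_{\mathbb{R}_+}$ of intensity $(1+U')\,d\lambda$. Then $$\mathcal{T}_{\rho_2}(\mu_\lambda,\nu)\le\|U\|_{L^2(\lambda)}.$$
   Context: $\Gamma_{\mathbb{R}_+}$ is the set of subsets $\omega$ of $\mathbb{R}_+$ having finite intersection with every compact set, each identified with the Radon measure $\sum_{x\in\omega}\varepsilon_x$ (sum of Dirac masses), endowed with the vague topology and its Borel $\sigma$-algebra. The Poisson measure of intensity $\sigma$ is the probability measure $\mu_\sigma$ with $\mathbb{E}_{\mu_\sigma}[\exp(\int f\,d\omega)]=\exp\{\int(e^f-1)\,d\sigma\}$ for all continuous compactly supported $f$. The Wasserstein distance (possibly infinite) on $\Gamma_{\mathbb{R}_+}$ is $$\rho_2(\omega,\eta)=\inf_{\beta\in\Sigma(\omega,\eta)}\sqrt{\int\int|x-y|^2\,d\beta(x,y)},$$ where $\Sigma(\omega,\eta)$ is the set of configurations $\beta\in\Gamma_{\mathbb{R}_+\times\mathbb{R}_+}$ with marginals $\omega$ and $\eta$ (and $\inf\emptyset=+\infty$). The Rubinstein distance is $\mathcal{T}_{\rho_2}(\mu,\nu)=\inf_\gamma\int\int\rho_2(\omega,\eta)\,d\gamma(\omega,\eta)$,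 the infimum running over probability measures $\gamma$ on $\Gamma_{\mathbb{R}_+}\times\Gamma_{\mathbb{R}_+}$ with marginals $\mu$ and $\nu$. *)

theory Defs
  imports "HOL-Probability.Probability"
begin

section \<open>Configuration spaces\<close>

definition configurations :: "'a::topological_space set \<Rightarrow> 'a set set" where
  "configurations X = {\<omega>. \<omega> \<subseteq> X \<and> (\<forall>K. compact K \<and> K \<subseteq> X \<longrightarrow> finite (\<omega> \<inter> K))}"

text \<open>The sum of the Dirac masses at the points of \<open>\<omega>\<close>, on the Borel sets of \<open>X\<close>. All measures
  live on \<^term>\<open>restrict_space borel X\<close>, so functions are only ever looked at on \<open>X\<close>.\<close>

definition config_measure :: "'a::topological_space set \<Rightarrow> 'a set \<Rightarrow> 'a measure" where
  "config_measure X \<omega> = distr (count_space \<omega>) (restrict_space borel X) (\<lambda>x. x)"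

definition test_function :: "'a::topological_space set \<Rightarrow> ('a \<Rightarrow> real) \<Rightarrow> bool" where
  "test_function X f \<longleftrightarrow>
     continuous_on X f \<and> (\<exists>K. compact K \<and> K \<subseteq> X \<and> (\<forall>x\<in>X - K. f x = 0))"

text \<open>The coarsest topology on \<^term>\<open>configurations X\<close> that makes \<open>\<omega> \<mapsto> \<integral> f d\<omega>\<close> continuous for every
  test function \<open>f\<close> (its underlying set is all of \<^term>\<open>configurations X\<close>, take \<open>V = UNIV\<close>).\<close>

definition vague_topology :: "'a::topological_space set \<Rightarrow> 'a set topology" where
  "vague_topology X = topology_generated_by
     {{\<omega> \<in> configurations X. (\<integral>x. f x \<partial>config_measure X \<omega>) \<in> V} | f V. test_function X f \<and> open V}"

definition config_borel :: "'a::topological_space set \<Rightarrow> 'a set measure" where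
  "config_borel X = sigma (configurations X) {W. openin (vague_topology X) W}"

text \<open>\<open>P\<close> is the Poisson measure of intensity \<open>\<sigma>\<close>, where \<open>\<sigma>\<close> is a Radon measure on
  \<^term>\<open>restrict_space borel X\<close>. Both sides of the Laplace identity are Bochner integrals; the
  right-hand side is positive, so the identity forces integrability on the left.\<close>

definition poisson_measure :: "'a::topological_space set \<Rightarrow> 'a measure \<Rightarrow> 'a set measure \<Rightarrow> bool" where
  "poisson_measure X \<sigma> P \<longleftrightarrow>
     prob_space P \<and> sets P = sets (config_borel X) \<and>
     (\<forall>f. test_function X f \<longrightarrow>
        (\<integral>\<omega>. exp (\<integral>x. f x \<partial>config_measure X \<omega>) \<partial>P) = exp (\<integral>x. (exp (f x) - 1) \<partial>\<sigma>))"

section \<open>Wasserstein and Rubinstein distances\<close>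

definition ennreal_sqrt :: "ennreal \<Rightarrow> ennreal" where
  "ennreal_sqrt a = (if a = \<top> then \<top> else ennreal (sqrt (enn2real a)))"

definition config_couplings :: "'a::topological_space set \<Rightarrow> 'a set \<Rightarrow> 'a set \<Rightarrow> ('a \<times> 'a) set set" where
  "config_couplings X \<omega> \<eta> = {\<beta> \<in> configurations (X \<times> X).
     distr (config_measure (X \<times> X) \<beta>) (restrict_space borel X) fst = config_measure X \<omega> \<and>
     distr (config_measure (X \<times> X) \<beta>) (restrict_space borel X) snd = config_measure X \<eta>}"

text \<open>The infimum over the empty set is \<open>\<top>\<close> in \<^typ>\<open>ennreal\<close>.\<close>

definition wasserstein_dist :: "'a::metric_space set \<Rightarrow> 'a set \<Rightarrow> 'a set \<Rightarrow> ennreal" where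
  "wasserstein_dist X \<omega> \<eta> = (INF \<beta>\<in>config_couplings X \<omega> \<eta>.
     ennreal_sqrt (\<integral>\<^sup>+z. ennreal ((dist (fst z) (snd z))\<^sup>2) \<partial>config_measure (X \<times> X) \<beta>))"

definition measure_couplings :: "'b measure \<Rightarrow> 'b measure \<Rightarrow> ('b \<times> 'b) measure set" where
  "measure_couplings \<mu> \<nu> = {\<gamma>. prob_space \<gamma> \<and> sets \<gamma> = sets (\<mu> \<Otimes>\<^sub>M \<nu>) \<and>
     distr \<gamma> \<mu> fst = \<mu> \<and> distr \<gamma> \<nu> snd = \<nu>}"

definition rubinstein_dist :: "('b \<Rightarrow> 'b \<Rightarrow> ennreal) \<Rightarrow> 'b measure \<Rightarrow> 'b measure \<Rightarrow> ennreal" where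
  "rubinstein_dist \<rho> \<mu> \<nu> =
     (INF \<gamma>\<in>measure_couplings \<mu> \<nu>. \<integral>\<^sup>+z. \<rho> (fst z) (snd z) \<partial>\<gamma>)"

section \<open>The half-line\<close>

abbreviation half_line :: "real set" where
  "half_line \<equiv> {0..}"

abbreviation half_lebesgue :: "real measure" where
  "half_lebesgue \<equiv> restrict_space lborel half_line"

definition L2_norm :: "'a measure \<Rightarrow> ('a \<Rightarrow> real) \<Rightarrow> real" where
  "L2_norm M f = sqrt (\<integral>x. (f x)\<^sup>2 \<partial>M)"

end

theory Submission
  imports Defs
begin

text \<open>
  Put \<open>\<phi> x = x + U x\<close>. Since \<open>U' > -1\<close>, \<open>U 0 = 0\<close> and \<open>U\<close> vanishes at infinity, \<open>\<phi>\<close> is an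
  increasing bijection of the half-line, and the substitution rule says that it carries the measure
  \<open>(1 + U') d\<lambda>\<close> to \<open>\<lambda>\<close>. Hence moving every point of a configuration by \<open>\<phi>\<close> carries \<open>\<nu>\<close> to \<open>\<mu>\<close>,
  and the law of \<open>(\<phi> ` \<omega>, \<omega>)\<close> under \<open>\<nu>\<close> is a coupling of \<open>\<mu>\<close> and \<open>\<nu>\<close>. Matching \<open>\<phi> x\<close> with
  \<open>x\<close> bounds the Wasserstein distance of \<open>\<phi> ` \<omega>\<close> and \<open>\<omega>\<close> by the square root of
  \<open>Z \<omega> = (\<Sum>x\<in>\<omega>. (U x)\<^sup>2)\<close>. By concavity of the square root, the cost of the coupling is at most the
  square root of the mean of \<open>Z\<close>, and by Campbell's formula that mean is \<open>\<integral> U\<^sup>2 (1 + U') d\<lambda>\<close>.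
  This integral equals \<open>\<integral> U\<^sup>2 d\<lambda>\<close>, because \<open>U\<^sup>2 U'\<close> is the derivative of \<open>U\<^sup>3 / 3\<close>, which vanishes
  at \<open>0\<close> and at infinity.

  The Poisson measures are known only through their Laplace functionals, so two facts have to be
  extracted from these. The first is uniqueness, which identifies the image of \<open>\<nu>\<close> with \<open>\<mu>\<close>
  (\<open>law_eq_if_laplace_eq\<close>, used in \<open>poisson_image_eq\<close>). The Laplace functional gives the probability
  of every void event \<open>{\<omega>. \<omega> \<inter> K = {}}\<close> with \<open>K\<close> compact, as the limit of
  \<open>E exp (- n \<integral> f\<^sub>n d\<omega>)\<close> for bumps \<open>f\<^sub>n\<close> decreasing to the indicator of \<open>K\<close>. Void events are stable under
  intersection, and they generate the Borel sets of the vague topology because configurations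
  have no multiple points: a point of \<open>\<omega>\<close> can be located by asking which small intervals are hit.
  The second is the inequality in Campbell's formula (\<open>poisson_campbell\<close>): compare the random
  variable \<open>X = \<integral> f d\<omega>\<close> with \<open>(exp (t X) - 1) / t \<ge> X\<close> and let \<open>t\<close> tend to \<open>0\<close>.
\<close>

section \<open>Configurations and their integrals\<close>

lemma configurationsD:
  assumes "\<omega> \<in> configurations X"
  shows "\<omega> \<subseteq> X" and "\<And>K. compact K \<Longrightarrow> K \<subseteq> X \<Longrightarrow> finite (\<omega> \<inter> K)"
  using assms by (auto simp: configurations_def)

lemma test_function_measurable:
  "test_function X f \<Longrightarrow> f \<in> borel_measurable (restrict_space borel X)"
  by (auto simp: test_function_def intro: borel_measurable_continuous_on_restrict)

lemma measurable_count_space_restrict_borel: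
  "\<omega> \<subseteq> X \<Longrightarrow> (\<lambda>x. x) \<in> count_space \<omega> \<rightarrow>\<^sub>M restrict_space borel X"
  by (auto simp: space_restrict_space)

lemma nn_integral_config_measure:
  assumes "\<omega> \<subseteq> X" and "g \<in> borel_measurable (restrict_space borel X)"
  shows "(\<integral>\<^sup>+x. g x \<partial>config_measure X \<omega>) = (\<integral>\<^sup>+x. g x \<partial>count_space \<omega>)"
  unfolding config_measure_def
  using assms by (subst nn_integral_distr) (auto simp: space_restrict_space)

text \<open>The integral is a finite sum, since a configuration has only finitely many points in the
  compact set outside which the integrand vanishes.\<close>

lemma integral_config_measure:
  fixes f :: "'a::topological_space \<Rightarrow> real"
  assumes "\<omega> \<in> configurations X" and "f \<in> borel_measurable (restrict_space borel X)"
    and "compact K" "K \<subseteq> X" and zero: "\<And>x. x \<in> X - K \<Longrightarrow> f x = 0"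
  shows "(\<integral>x. f x \<partial>config_measure X \<omega>) = (\<Sum>x\<in>\<omega> \<inter> K. f x)"
proof -
  note \<omega> = configurationsD[OF assms(1)]
  have fin: "finite (\<omega> \<inter> K)" using \<omega>(2) assms by blast
  have sub: "{x \<in> \<omega>. f x \<noteq> 0} \<subseteq> \<omega> \<inter> K" using zero \<omega>(1) by blast
  have "(\<integral>x. f x \<partial>config_measure X \<omega>) = (\<integral>x. f x \<partial>count_space \<omega>)"
    unfolding config_measure_def
    using assms(2) \<omega>(1) by (subst integral_distr) (auto simp: space_restrict_space)
  also have "\<dots> = (\<Sum>x | x \<in> \<omega> \<and> f x \<noteq> 0. f x)"
    using finite_subset[OF sub fin] by (rule lebesgue_integral_count_space_finite_support)
  also have "\<dots> = (\<Sum>x\<in>\<omega> \<inter> K. f x)"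
    using fin sub by (intro sum.mono_neutral_left) auto
  finally show ?thesis .
qed

lemma integral_config_measure_nonneg:
  fixes f :: "'a::topological_space \<Rightarrow> real"
  assumes "\<omega> \<subseteq> X" and "\<And>x. x \<in> X \<Longrightarrow> 0 \<le> f x"
  shows "0 \<le> (\<integral>x. f x \<partial>config_measure X \<omega>)"
  using assms by (intro integral_nonneg_AE AE_I2) (auto simp: config_measure_def space_restrict_space)

lemma nn_integral_config_measure_test_function:
  fixes f :: "'a::topological_space \<Rightarrow> real"
  assumes \<omega>: "\<omega> \<in> configurations X" and f: "test_function X f" and nonneg: "\<And>x. x \<in> X \<Longrightarrow> 0 \<le> f x"
  shows "(\<integral>\<^sup>+x. ennreal (f x) \<partial>config_measure X \<omega>) = ennreal (\<integral>x. f x \<partial>config_measure X \<omega>)"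
proof -
  obtain K where K: "compact K" "K \<subseteq> X" "\<And>x. x \<in> X - K \<Longrightarrow> f x = 0"
    using f by (auto simp: test_function_def)
  note fm[measurable] = test_function_measurable[OF f]
  have fin: "finite (\<omega> \<inter> K)" using configurationsD[OF \<omega>] K by blast
  have "(\<integral>\<^sup>+x. ennreal (f x) \<partial>config_measure X \<omega>) = (\<integral>\<^sup>+x. ennreal (f x) \<partial>count_space \<omega>)"
    using configurationsD[OF \<omega>] by (intro nn_integral_config_measure) auto
  also have "\<dots> = (\<Sum>x\<in>\<omega> \<inter> K. ennreal (f x))"
  proof (rule nn_integral_count_space'[OF fin])
    show "ennreal (f x) = 0" if "x \<in> \<omega>" "x \<notin> \<omega> \<inter> K" for x
      using that configurationsD(1)[OF \<omega>] K(3)[of x] by auto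
  qed auto
  also have "\<dots> = ennreal (\<Sum>x\<in>\<omega> \<inter> K. f x)"
    using nonneg configurationsD(1)[OF \<omega>] by (intro sum_ennreal) auto
  also have "(\<Sum>x\<in>\<omega> \<inter> K. f x) = (\<integral>x. f x \<partial>config_measure X \<omega>)"
    using integral_config_measure[OF \<omega> fm K] by simp
  finally show ?thesis .
qed

lemma openin_vague_subset: "openin (vague_topology X) W \<Longrightarrow> W \<subseteq> configurations X"
  using openin_subset[of "vague_topology X" W] by (auto simp: vague_topology_def)

lemma space_config_borel [simp]: "space (config_borel X) = configurations X"
  unfolding config_borel_def by (rule space_measure_of) (auto dest: openin_vague_subset)

lemma sets_config_borel:
  "sets (config_borel X) = sigma_sets (configurations X) {W. openin (vague_topology X) W}"
  unfolding config_borel_def by (rule sets_measure_of) (auto dest: openin_vague_subset)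

lemma openin_vague_integral:
  "test_function X f \<Longrightarrow> open V \<Longrightarrow>
     openin (vague_topology X) {\<omega> \<in> configurations X. (\<integral>x. f x \<partial>config_measure X \<omega>) \<in> V}"
  unfolding vague_topology_def openin_topology_generated_by_iff
  by (rule generate_topology_on.Basis) blast

lemma measurable_integral_config_measure:
  assumes "test_function X f"
  shows "(\<lambda>\<omega>. \<integral>x. f x \<partial>config_measure X \<omega>) \<in> borel_measurable (config_borel X)"
proof (rule borel_measurableI)
  fix V :: "real set" assume "open V"
  have eq: "(\<lambda>\<omega>. \<integral>x. f x \<partial>config_measure X \<omega>) -` V \<inter> space (config_borel X)
    = {\<omega> \<in> configurations X. (\<integral>x. f x \<partial>config_measure X \<omega>) \<in> V}" by auto
  show "(\<lambda>\<omega>. \<integral>x. f x \<partial>config_measure X \<omega>) -` V \<inter> space (config_borel X) \<in> sets (config_borel X)"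
    unfolding eq sets_config_borel
    using openin_vague_integral[OF assms \<open>open V\<close>] by auto
qed

lemma poisson_measureD:
  assumes "poisson_measure X \<sigma> P"
  shows "prob_space P" and "sets P = sets (config_borel X)" and "space P = configurations X"
    and "\<And>f. test_function X f \<Longrightarrow>
        (\<integral>\<omega>. exp (\<integral>x. f x \<partial>config_measure X \<omega>) \<partial>P) = exp (\<integral>x. (exp (f x) - 1) \<partial>\<sigma>)"
  using assms sets_eq_imp_space_eq[of P "config_borel X"] by (auto simp: poisson_measure_def)

section \<open>Void events\<close>

text \<open>The events that avoid a given set. Their probabilities, for compact sets, determine the law of a
  random configuration without multiple points.\<close>

definition void_event :: "'a::topological_space set \<Rightarrow> 'a set \<Rightarrow> 'a set set" where
  "void_event X K = {\<omega> \<in> configurations X. \<omega> \<inter> K = {}}"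

text \<open>A continuous approximation of the indicator of \<open>K\<close> from above, decreasing in \<open>n\<close>; all the bumps
  vanish at distance more than \<open>1\<close> from \<open>K\<close>.\<close>

definition bump :: "'a::metric_space set \<Rightarrow> nat \<Rightarrow> 'a \<Rightarrow> real" where
  "bump K n x = max 0 (1 - real (Suc n) * infdist x K)"

lemma bump_nonneg: "0 \<le> bump K n x"
  by (simp add: bump_def)

lemma bump_eq_1: "x \<in> K \<Longrightarrow> bump K n x = 1"
  by (simp add: bump_def)

lemma bump_eq_0:
  assumes "1 < infdist x K"
  shows "bump K n x = 0"
proof -
  have "1 * 1 \<le> real (Suc n) * infdist x K" using assms by (intro mult_mono) auto
  then show ?thesis by (simp add: bump_def)
qed

lemma bump_support:
  fixes X :: "'a::heine_borel set"
  assumes "closed X" "compact K" "K \<subseteq> X" "K \<noteq> {}"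
  shows "compact {x \<in> X. infdist x K \<le> 1}" "{x \<in> X. infdist x K \<le> 1} \<subseteq> X"
    "\<And>x. x \<in> X - {x \<in> X. infdist x K \<le> 1} \<Longrightarrow> bump K n x = 0"
proof -
  have "{x \<in> X. infdist x K \<le> 1} = X \<inter> {x. infdist x K \<le> 1}" by auto
  then show "compact {x \<in> X. infdist x K \<le> 1}"
    using closed_Int_compact[OF assms(1) compact_infdist_le[OF assms(4,2), of 1]] by simp
qed (auto intro!: bump_eq_0)

lemma test_function_bump:
  fixes X :: "'a::heine_borel set"
  assumes "closed X" "compact K" "K \<subseteq> X" "K \<noteq> {}"
  shows "test_function X (\<lambda>x. c * bump K n x)"
  unfolding test_function_def
proof (intro conjI exI)
  show "continuous_on X (\<lambda>x. c * bump K n x)"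
    unfolding bump_def by (intro continuous_intros)
  show "compact {x \<in> X. infdist x K \<le> 1}" "{x \<in> X. infdist x K \<le> 1} \<subseteq> X"
    "\<forall>x\<in>X - {x \<in> X. infdist x K \<le> 1}. c * bump K n x = 0"
    using bump_support[OF assms] by auto
qed

text \<open>Only the finitely many points of \<open>\<omega>\<close> at distance at most \<open>1\<close> from \<open>K\<close> are ever seen by the bumps,
  and each of them has a positive distance from the closed set \<open>K\<close>.\<close>

lemma integral_bump_eventually_0:
  fixes X :: "'a::heine_borel set"
  assumes X: "closed X" and K: "compact K" "K \<subseteq> X" "K \<noteq> {}"
    and \<omega>: "\<omega> \<in> void_event X K"
  shows "\<forall>\<^sub>F n in sequentially. \<forall>c. (\<integral>x. c * bump K n x \<partial>config_measure X \<omega>) = 0"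
proof -
  define S where "S = \<omega> \<inter> {x \<in> X. infdist x K \<le> 1}"
  have conf: "\<omega> \<in> configurations X" and disj: "\<omega> \<inter> K = {}" using \<omega> by (auto simp: void_event_def)
  have "finite S" unfolding S_def using configurationsD(2)[OF conf] bump_support[OF X K] by blast
  moreover have "\<forall>\<^sub>F n in sequentially. bump K n x = 0" if "x \<in> S" for x
  proof -
    have "x \<notin> K" using that disj by (auto simp: S_def)
    then have pos: "0 < infdist x K"
      using K infdist_pos_not_in_closed[of K x] compact_imp_closed by blast
    then obtain N where N: "1 < real N * infdist x K" using reals_Archimedean3 by blast
    show ?thesis
    proof (rule eventually_sequentiallyI)
      fix n assume "N \<le> n"
      then have "real N * infdist x K \<le> real (Suc n) * infdist x K"
        using pos by (intro mult_right_mono) auto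
      then show "bump K n x = 0" using N by (simp add: bump_def)
    qed
  qed
  ultimately have "\<forall>\<^sub>F n in sequentially. \<forall>x\<in>S. bump K n x = 0"
    by (intro eventually_ball_finite) auto
  then show ?thesis
  proof eventually_elim
    case (elim n)
    show ?case
    proof
      fix c
      have "(\<integral>x. c * bump K n x \<partial>config_measure X \<omega>) = (\<Sum>x\<in>S. c * bump K n x)"
        unfolding S_def
        using integral_config_measure[OF conf test_function_measurable[OF test_function_bump[OF X K, of c n]]
            bump_support(1,2)[OF X K]] bump_support(3)[OF X K, of _ n] by auto
      then show "(\<integral>x. c * bump K n x \<partial>config_measure X \<omega>) = 0" using elim by simp
    qed
  qed
qed

lemma integral_bump_ge_1:
  fixes X :: "'a::heine_borel set"
  assumes X: "closed X" and K: "compact K" "K \<subseteq> X" "K \<noteq> {}"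
    and \<omega>: "\<omega> \<in> configurations X - void_event X K"
  shows "1 \<le> (\<integral>x. bump K n x \<partial>config_measure X \<omega>)"
proof -
  define S where "S = \<omega> \<inter> {x \<in> X. infdist x K \<le> 1}"
  have conf: "\<omega> \<in> configurations X" using \<omega> by auto
  obtain y where y: "y \<in> \<omega>" "y \<in> K" using \<omega> by (auto simp: void_event_def)
  have "finite S" unfolding S_def using configurationsD(2)[OF conf] bump_support[OF X K] by blast
  moreover have "y \<in> S" using y K by (auto simp: S_def)
  ultimately have "bump K n y \<le> (\<Sum>x\<in>S. bump K n x)"
    by (intro member_le_sum) (auto simp: bump_nonneg)
  also have "\<dots> = (\<integral>x. bump K n x \<partial>config_measure X \<omega>)"
    using integral_config_measure[OF conf test_function_measurable[OF test_function_bump[OF X K, of 1 n]]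
            bump_support(1,2)[OF X K]] bump_support(3)[OF X K, of _ n] by (auto simp: S_def)
  finally show ?thesis using y(2) by (simp add: bump_eq_1)
qed

lemma void_event_empty: "void_event X {} = configurations X"
  by (auto simp: void_event_def)

text \<open>The number of points in a compact set is upper semicontinuous: avoiding \<open>K\<close> means that the
  integral of some bump is less than \<open>1\<close>.\<close>

lemma openin_void_event:
  fixes X :: "'a::heine_borel set"
  assumes "closed X" "compact K" "K \<subseteq> X" "K \<noteq> {}"
  shows "openin (vague_topology X) (void_event X K)"
proof -
  let ?A = "\<lambda>n. {\<omega> \<in> configurations X. (\<integral>x. bump K n x \<partial>config_measure X \<omega>) \<in> {..<1}}"
  have "void_event X K = (\<Union>n. ?A n)"
  proof (intro equalityI subsetI)
    fix \<omega> assume \<omega>: "\<omega> \<in> void_event X K"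
    obtain n where "(\<integral>x. 1 * bump K n x \<partial>config_measure X \<omega>) = 0"
      using integral_bump_eventually_0[OF assms \<omega>] by (auto simp: eventually_sequentially)
    then have "\<omega> \<in> ?A n" using \<omega> by (simp add: void_event_def)
    then show "\<omega> \<in> (\<Union>n. ?A n)" by blast
  next
    fix \<omega> assume "\<omega> \<in> (\<Union>n. ?A n)"
    then obtain n where n: "\<omega> \<in> ?A n" by blast
    then show "\<omega> \<in> void_event X K" using integral_bump_ge_1[OF assms, of \<omega> n] by auto
  qed
  moreover have "openin (vague_topology X) (?A n)" for n
    using test_function_bump[OF assms, of 1 n] by (intro openin_vague_integral) auto
  ultimately show ?thesis by (auto intro!: openin_Union)
qed

lemma sets_void_event:
  fixes X :: "'a::heine_borel set"
  assumes "closed X" "compact K" "K \<subseteq> X"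
  shows "void_event X K \<in> sets (config_borel X)"
proof (cases "K = {}")
  case True
  then show ?thesis using sets.top[of "config_borel X"] by (simp add: void_event_empty)
next
  case False
  then show ?thesis
    using openin_void_event[OF assms] by (auto simp: sets_config_borel)
qed

text \<open>The right-hand side is the mean of the limit of the random variables on the left: the
  exponent is eventually \<open>0\<close> if \<open>\<omega>\<close> avoids \<open>K\<close>, and is at most \<open>- n\<close> otherwise.\<close>

lemma prob_void_event:
  fixes X :: "'a::heine_borel set"
  assumes X: "closed X" and K: "compact K" "K \<subseteq> X" "K \<noteq> {}"
    and P: "prob_space P" "sets P = sets (config_borel X)"
  shows "(\<lambda>n. \<integral>\<omega>. exp (\<integral>x. - real n * bump K n x \<partial>config_measure X \<omega>) \<partial>P)
           \<longlonglongrightarrow> measure P (void_event X K)"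
proof -
  interpret prob_space P by fact
  have sp: "space P = configurations X" using sets_eq_imp_space_eq[OF P(2)] by simp
  have meas: "(\<lambda>\<omega>. \<integral>x. - real n * bump K n x \<partial>config_measure X \<omega>) \<in> borel_measurable P" for n
    using measurable_integral_config_measure[OF test_function_bump[OF X K, of "- real n" n]]
    by (simp add: measurable_cong_sets[OF P(2) refl])
  have [measurable]: "void_event X K \<in> sets P"
    using sets_void_event[OF X K(1,2)] P(2) by simp
  have eq: "(\<integral>x. - real n * bump K n x \<partial>config_measure X \<omega>)
      = - (real n * (\<integral>x. bump K n x \<partial>config_measure X \<omega>))" for n \<omega> by simp
  have "(\<lambda>n. \<integral>\<omega>. exp (\<integral>x. - real n * bump K n x \<partial>config_measure X \<omega>) \<partial>P)
           \<longlonglongrightarrow> (\<integral>\<omega>. indicator (void_event X K) \<omega> \<partial>P)"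
  proof (rule integral_dominated_convergence[where w = "\<lambda>_. 1"])
    show "(\<lambda>\<omega>. exp (\<integral>x. - real n * bump K n x \<partial>config_measure X \<omega>)) \<in> borel_measurable P" for n
      using meas[of n] by measurable
    show "AE \<omega> in P. norm (exp (\<integral>x. - real n * bump K n x \<partial>config_measure X \<omega>)) \<le> 1" for n
    proof (rule AE_I2)
      fix \<omega> assume "\<omega> \<in> space P"
      then have "0 \<le> (\<integral>x. bump K n x \<partial>config_measure X \<omega>)"
        by (intro integral_config_measure_nonneg) (auto simp: sp bump_nonneg dest: configurationsD(1))
      then show "norm (exp (\<integral>x. - real n * bump K n x \<partial>config_measure X \<omega>)) \<le> 1"
        unfolding eq by simp
    qed
    show "AE \<omega> in P. (\<lambda>n. exp (\<integral>x. - real n * bump K n x \<partial>config_measure X \<omega>))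
        \<longlonglongrightarrow> indicator (void_event X K) \<omega>"
    proof (rule AE_I2)
      fix \<omega> assume \<omega>: "\<omega> \<in> space P"
      show "(\<lambda>n. exp (\<integral>x. - real n * bump K n x \<partial>config_measure X \<omega>))
        \<longlonglongrightarrow> indicator (void_event X K) \<omega>"
      proof (cases "\<omega> \<in> void_event X K")
        case True
        have "\<forall>\<^sub>F n in sequentially. exp (\<integral>x. - real n * bump K n x \<partial>config_measure X \<omega>) = 1"
          using integral_bump_eventually_0[OF X K True] by eventually_elim (metis exp_zero)
        then show ?thesis using True by (simp add: tendsto_eventually)
      next
        case False
        have le: "exp (\<integral>x. - real n * bump K n x \<partial>config_measure X \<omega>) \<le> exp (- real n)" for n
          unfolding eq using integral_bump_ge_1[OF X K, of \<omega> n] \<omega> False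
          by (auto simp: sp intro: order_trans[OF _ mult_left_mono[of 1]])
        have "(\<lambda>n. exp (- real n)) \<longlonglongrightarrow> 0"
          by (rule filterlim_compose[OF exp_at_bot])
            (simp add: filterlim_uminus_at_bot filterlim_real_sequentially)
        then have "(\<lambda>n. exp (\<integral>x. - real n * bump K n x \<partial>config_measure X \<omega>)) \<longlonglongrightarrow> 0"
          by (rule tendsto_sandwich[OF _ _ tendsto_const, rotated 2]) (use le in auto)
        then show ?thesis using False by simp
      qed
    qed
  qed auto
  then show ?thesis by simp
qed

section \<open>Void events generate the Borel sets of configurations on the half-line\<close>

definition single_event :: "real \<Rightarrow> real \<Rightarrow> real set set" where
  "single_event p q = {\<omega> \<in> configurations half_line. \<exists>y. \<omega> \<inter> {p<..<q} = {y}}"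

text \<open>Countably many events that replace a countable basis of the vague topology: every vague
  neighbourhood of \<open>\<omega>\<close> contains a finite intersection of them to which \<open>\<omega>\<close> belongs. Such an
  intersection prescribes one point in each of finitely many rational intervals and no other
  point up to \<open>b\<close>.\<close>

definition cell_events :: "real set set set" where
  "cell_events =
     (\<lambda>(p, q). single_event p q) ` (\<rat> \<times> \<rat>) \<union>
     (\<lambda>(b, L). void_event half_line ({0..b} - (\<Union>(p, q)\<in>L. {p<..<q}))) `
       (\<rat> \<times> {L. finite L \<and> L \<subseteq> \<rat> \<times> \<rat>})"

abbreviation void_algebra :: "real set set set" where
  "void_algebra \<equiv> sigma_sets (configurations half_line)
     {void_event half_line K | K. compact K \<and> K \<subseteq> half_line}"

lemma sigma_algebra_void_algebra: "sigma_algebra (configurations half_line) void_algebra"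
  by (rule sigma_algebra_sigma_sets) (auto simp: void_event_def)

text \<open>Avoiding a countable union of compact sets is a countable intersection of void events.\<close>

lemma void_event_open_interval:
  "void_event half_line ({p<..<q} \<inter> half_line) \<in> void_algebra"
proof -
  interpret sigma_algebra "configurations half_line" void_algebra
    by (rule sigma_algebra_void_algebra)
  let ?K = "\<lambda>n. {p + inverse (real (Suc n)) .. q - inverse (real (Suc n))} \<inter> half_line"
  have "{p<..<q} \<subseteq> (\<Union>n. {p + inverse (real (Suc n)) .. q - inverse (real (Suc n))})"
  proof
    fix x assume x: "x \<in> {p<..<q}"
    then have "0 < min (x - p) (q - x)" by simp
    then obtain n where "inverse (real (Suc n)) < min (x - p) (q - x)"
      using reals_Archimedean by blast
    then show "x \<in> (\<Union>n. {p + inverse (real (Suc n)) .. q - inverse (real (Suc n))})"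
      by (auto intro!: exI[of _ n])
  qed
  moreover have "?K n \<subseteq> {p<..<q} \<inter> half_line" for n
  proof -
    have "0 < inverse (real (Suc n))" by simp
    then have "p < x" "x < q" if "x \<in> ?K n" for x
      using that unfolding Int_iff atLeastAtMost_iff by linarith+
    then show ?thesis by auto
  qed
  ultimately have "{p<..<q} \<inter> half_line = (\<Union>n. ?K n)" by blast
  then have eq: "void_event half_line ({p<..<q} \<inter> half_line) = (\<Inter>n. void_event half_line (?K n))"
    unfolding void_event_def by blast
  have "void_event half_line (?K n) \<in> void_algebra" for n
    by (intro sigma_sets.Basic) (auto intro!: compact_Int_closed)
  then show ?thesis unfolding eq by (intro countable_INT) auto
qed

text \<open>Two distinct points of \<open>\<omega>\<close> in the interval are separated by a rational number \<open>c\<close>, so that the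
  parts of the interval on both sides of \<open>c\<close> are hit. Having at least two points is therefore a
  countable union of events that only speak of hitting intervals.\<close>

lemma single_event_in_void_algebra: "single_event p q \<in> void_algebra"
proof -
  interpret sigma_algebra "configurations half_line" void_algebra
    by (rule sigma_algebra_void_algebra)
  define hit where "hit a b = configurations half_line - void_event half_line ({a<..<b} \<inter> half_line)"
    for a b
  have hit_iff: "\<omega> \<in> hit a b \<longleftrightarrow> \<omega> \<in> configurations half_line \<and> (\<exists>x\<in>\<omega>. a < x \<and> x < b)" for \<omega> a b
    using configurationsD(1)[of \<omega> half_line] unfolding hit_def void_event_def by force
  have hit: "hit a b \<in> void_algebra" for a b
    unfolding hit_def using void_event_open_interval by (rule compl_sets)
  have "single_event p q = hit p q - (\<Union>c\<in>\<rat>. hit p (min c q) \<inter> hit (max c p) q)"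
  proof (intro equalityI subsetI)
    fix \<omega> assume "\<omega> \<in> single_event p q"
    then obtain y where conf: "\<omega> \<in> configurations half_line" and y: "\<omega> \<inter> {p<..<q} = {y}"
      unfolding single_event_def by blast
    then have uniq: "z = y" if "z \<in> \<omega>" "p < z" "z < q" for z
      using that y by (metis Int_iff greaterThanLessThan_iff singletonD)
    have "y \<in> \<omega>" "p < y" "y < q" using y by auto
    then have "\<omega> \<in> hit p q" using conf unfolding hit_iff by blast
    moreover have "\<omega> \<notin> hit p (min c q) \<inter> hit (max c p) q" for c
    proof
      assume "\<omega> \<in> hit p (min c q) \<inter> hit (max c p) q"
      then obtain x z where "x \<in> \<omega>" "p < x" "x < min c q" "z \<in> \<omega>" "max c p < z" "z < q"
        unfolding hit_iff Int_iff by blast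
      with uniq[of x] uniq[of z] show False by simp
    qed
    ultimately show "\<omega> \<in> hit p q - (\<Union>c\<in>\<rat>. hit p (min c q) \<inter> hit (max c p) q)" by blast
  next
    fix \<omega> assume \<omega>: "\<omega> \<in> hit p q - (\<Union>c\<in>\<rat>. hit p (min c q) \<inter> hit (max c p) q)"
    then obtain y where y: "y \<in> \<omega>" "p < y" "y < q" and conf: "\<omega> \<in> configurations half_line"
      by (auto simp: hit_iff)
    have no: False if xz: "x \<in> \<omega>" "z \<in> \<omega>" "p < x" "x < z" "z < q" for x z
    proof -
      obtain c where "c \<in> \<rat>" "x < c" "c < z" using Rats_dense_in_real[OF \<open>x < z\<close>] by blast
      then have "\<omega> \<in> hit p (min c q) \<inter> hit (max c p) q"
        using xz conf by (auto simp: hit_iff)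
      with \<omega> \<open>c \<in> \<rat>\<close> show False by blast
    qed
    have "z = y" if "z \<in> \<omega>" "p < z" "z < q" for z
      using no[of y z] no[of z y] that y by (meson linorder_neqE_linordered_idom)
    then have "\<omega> \<inter> {p<..<q} = {y}"
      using y unfolding set_eq_iff Int_iff greaterThanLessThan_iff singleton_iff by blast
    then show "\<omega> \<in> single_event p q" using conf unfolding single_event_def by blast
  qed
  moreover have "(\<Union>c\<in>\<rat>. hit p (min c q) \<inter> hit (max c p) q) \<in> void_algebra"
    by (rule countable_UN''[OF countable_rat Int[OF hit hit]])
  then have "hit p q - (\<Union>c\<in>\<rat>. hit p (min c q) \<inter> hit (max c p) q) \<in> void_algebra"
    by (rule Diff[OF hit])
  ultimately show ?thesis by (simp only:)
qed

lemma cell_events_subset: "cell_events \<subseteq> void_algebra"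
proof -
  have "void_event half_line ({0..b} - (\<Union>(p, q)\<in>L. {p<..<q})) \<in> void_algebra" for b L
  proof (intro sigma_sets.Basic CollectI exI conjI refl)
    show "compact ({0..b} - (\<Union>(p, q)\<in>L. {p<..<q}))"
      by (intro compact_diff open_UN) auto
  qed auto
  then show ?thesis by (auto simp: cell_events_def single_event_in_void_algebra)
qed

lemma countable_cell_events: "countable cell_events"
  unfolding cell_events_def
  by (intro countable_Un countable_image countable_SIGMA countable_Collect_finite_subset countable_rat)

text \<open>If \<open>f\<close> vanishes beyond \<open>b\<close>, then a configuration with one point close to each point of
  \<open>\<omega> \<inter> {0..b}\<close> and no other point in \<open>{0..b}\<close> has almost the same integral of \<open>f\<close> as \<open>\<omega>\<close>.\<close>

lemma vague_subbasis_cell_events: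
  fixes f :: "real \<Rightarrow> real"
  assumes f: "test_function half_line f" and V: "open V"
    and \<omega>: "\<omega> \<in> configurations half_line" and in_V: "(\<integral>x. f x \<partial>config_measure half_line \<omega>) \<in> V"
  obtains F where "finite F" "F \<subseteq> cell_events" "\<omega> \<in> \<Inter>F"
    "configurations half_line \<inter> \<Inter>F \<subseteq>
       {\<omega> \<in> configurations half_line. (\<integral>x. f x \<partial>config_measure half_line \<omega>) \<in> V}"
proof -
  obtain K where "compact K" and K: "\<And>x. x \<in> half_line - K \<Longrightarrow> f x = 0"
    using f by (auto simp: test_function_def)
  obtain B where B: "\<And>x. x \<in> K \<Longrightarrow> \<bar>x\<bar> \<le> B"
    using compact_imp_bounded[OF \<open>compact K\<close>] by (auto simp: bounded_iff)
  obtain b where b: "b \<in> \<rat>" "B < b" using Rats_dense_in_real[of B "B + 1"] by auto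
  have fb: "f x = 0" if "x \<in> half_line - {0..b}" for x
    using K[of x] B[of x] b that by force
  have cont: "continuous_on half_line f" using f by (auto simp: test_function_def)
  have int_eq: "(\<integral>x. f x \<partial>config_measure half_line \<eta>) = (\<Sum>x\<in>\<eta> \<inter> {0..b}. f x)"
    if "\<eta> \<in> configurations half_line" for \<eta>
    using that fb by (intro integral_config_measure test_function_measurable f) auto
  define S where "S = \<omega> \<inter> {0..b}"
  \<comment> \<open>The larger set \<open>T\<close> contains every point of \<open>\<omega>\<close> within distance \<open>1\<close> of \<open>S\<close>, also those beyond \<open>b\<close>.\<close>
  define T where "T = \<omega> \<inter> {0..b + 1}"
  have T: "finite T" unfolding T_def using configurationsD(2)[OF \<omega>] by auto
  have S: "finite S" and ST: "S \<subseteq> T"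
    using configurationsD(2)[OF \<omega>] by (auto simp: S_def T_def)
  obtain e where e: "0 < e" "\<And>s. dist s (\<Sum>x\<in>S. f x) < e \<Longrightarrow> s \<in> V"
    using V in_V int_eq[OF \<omega>] unfolding open_dist S_def by metis
  \<comment> \<open>One more than the cardinality, so that \<open>card S\<close> errors stay below \<open>e\<close> also when \<open>S\<close> is empty.\<close>
  define e' where "e' = e / (real (card S) + 1)"
  have "0 < e'" using e(1) by (simp add: e'_def)
  have "\<forall>\<^sub>F d in at_right 0. \<forall>x\<in>S. \<forall>y\<in>half_line. \<bar>y - x\<bar> < d \<longrightarrow> \<bar>f y - f x\<bar> < e'"
  proof (rule eventually_ball_finite[OF S], rule ballI)
    fix x assume "x \<in> S"
    then have "x \<in> half_line" by (auto simp: S_def)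
    then obtain d where "0 < d" "\<And>y. y \<in> half_line \<Longrightarrow> \<bar>y - x\<bar> < d \<Longrightarrow> \<bar>f y - f x\<bar> < e'"
      using cont \<open>0 < e'\<close> unfolding continuous_on_iff dist_real_def by metis
    then show "\<forall>\<^sub>F d in at_right 0. \<forall>y\<in>half_line. \<bar>y - x\<bar> < d \<longrightarrow> \<bar>f y - f x\<bar> < e'"
      unfolding eventually_at_right_field by (metis less_trans)
  qed
  moreover have "\<forall>\<^sub>F d in at_right 0. \<forall>x\<in>T. \<forall>y\<in>T. x \<noteq> y \<longrightarrow> 2 * d < \<bar>y - x\<bar>"
  proof (rule eventually_ball_finite[OF T], rule ballI, rule eventually_ball_finite[OF T], rule ballI)
    fix x y assume "x \<in> T" "y \<in> T"
    show "\<forall>\<^sub>F d in at_right 0. x \<noteq> y \<longrightarrow> 2 * d < \<bar>y - x\<bar>"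
    proof (cases "x = y")
      case False
      then show ?thesis
        unfolding eventually_at_right_field by (intro exI[of _ "\<bar>y - x\<bar> / 2"]) auto
    qed simp
  qed
  moreover have "\<forall>\<^sub>F d in at_right (0::real). 0 < d \<and> d < 1"
    unfolding eventually_at_right_field by (intro exI[of _ 1]) auto
  ultimately have "\<forall>\<^sub>F d in at_right 0. (\<forall>x\<in>S. \<forall>y\<in>half_line. \<bar>y - x\<bar> < d \<longrightarrow> \<bar>f y - f x\<bar> < e')
      \<and> (\<forall>x\<in>T. \<forall>y\<in>T. x \<noteq> y \<longrightarrow> 2 * d < \<bar>y - x\<bar>) \<and> 0 < d \<and> d < 1"
    by eventually_elim auto
  from eventually_happens'[OF trivial_limit_at_right_real this]
  obtain d where d: "\<And>x y. x \<in> S \<Longrightarrow> y \<in> half_line \<Longrightarrow> \<bar>y - x\<bar> < d \<Longrightarrow> \<bar>f y - f x\<bar> < e'"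
      "\<And>x y. x \<in> T \<Longrightarrow> y \<in> T \<Longrightarrow> x \<noteq> y \<Longrightarrow> 2 * d < \<bar>y - x\<bar>" "0 < d" "d < 1"
    by blast
  \<comment> \<open>The intervals of radius \<open>d\<close> around points of \<open>T\<close> are disjoint; shrink them to rational ends.\<close>
  have "\<forall>x. \<exists>r\<in>\<rat>. x - d < r \<and> r < x" "\<forall>x. \<exists>r\<in>\<rat>. x < r \<and> r < x + d"
    using Rats_dense_in_real d(3) by simp_all
  then obtain p q where pq: "\<And>x. p x \<in> \<rat>" "\<And>x. q x \<in> \<rat>"
      "\<And>x. x - d < p x" "\<And>x. p x < x" "\<And>x. x < q x" "\<And>x. q x < x + d"
    unfolding Bex_def choice_iff by blast
  let ?R = "{0..b} - (\<Union>(p, q)\<in>(\<lambda>x. (p x, q x)) ` S. {p<..<q})"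
  define F where "F = insert (void_event half_line ?R) ((\<lambda>x. single_event (p x) (q x)) ` S)"
  have near: "\<bar>y - x\<bar> < d" if "y \<in> {p x<..<q x}" for x y
    using that pq(3)[of x] pq(6)[of x] by auto
  show ?thesis
  proof (rule that)
    show "finite F" unfolding F_def using S by simp
    have "void_event half_line ?R \<in> cell_events"
      unfolding cell_events_def
      by (rule UnI2, rule image_eqI[of _ _ "(b, (\<lambda>x. (p x, q x)) ` S)"]) (use b S pq in auto)
    moreover have "single_event (p x) (q x) \<in> cell_events" for x
      unfolding cell_events_def
      by (rule UnI1, rule image_eqI[of _ _ "(p x, q x)"]) (use pq in auto)
    ultimately show "F \<subseteq> cell_events" unfolding F_def by auto
    show "\<omega> \<in> \<Inter>F"
    proof
      fix W assume "W \<in> F"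
      then consider "W = void_event half_line ?R" | x where "x \<in> S" "W = single_event (p x) (q x)"
        by (auto simp: F_def)
      then show "\<omega> \<in> W"
      proof cases
        case 1
        have "\<omega> \<inter> ?R = {}" using pq(4,5) by (auto simp: S_def)
        then show ?thesis using 1 \<omega> by (simp add: void_event_def)
      next
        case 2
        have "\<omega> \<inter> {p x<..<q x} = {x}"
        proof (intro equalityI subsetI)
          fix y assume y: "y \<in> \<omega> \<inter> {p x<..<q x}"
          then have "\<bar>y - x\<bar> < d" using near by blast
          moreover have "y \<in> T"
            using y calculation 2(1) d(4) configurationsD(1)[OF \<omega>] by (auto simp: T_def S_def)
          ultimately show "y \<in> {x}" using d(2)[of x y] 2(1) ST d(3) by auto
        next
          fix y assume "y \<in> {x}"
          then show "y \<in> \<omega> \<inter> {p x<..<q x}" using 2(1) pq(4,5)[of x] by (auto simp: S_def)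
        qed
        then show ?thesis using 2 \<omega> by (auto simp: single_event_def)
      qed
    qed
    show "configurations half_line \<inter> \<Inter>F \<subseteq>
       {\<omega> \<in> configurations half_line. (\<integral>x. f x \<partial>config_measure half_line \<omega>) \<in> V}"
    proof
      fix \<eta> assume \<eta>: "\<eta> \<in> configurations half_line \<inter> \<Inter>F"
      then have conf: "\<eta> \<in> configurations half_line" by blast
      have "\<forall>x\<in>S. \<exists>y. \<eta> \<inter> {p x<..<q x} = {y}"
        using \<eta> by (auto simp: F_def single_event_def)
      then obtain y where y: "\<And>x. x \<in> S \<Longrightarrow> \<eta> \<inter> {p x<..<q x} = {y x}" by metis
      have y': "y x \<in> \<eta>" "\<bar>y x - x\<bar> < d" if "x \<in> S" for x
        using y[OF that] near[of "y x" x] by blast+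
      have "\<eta> \<inter> ?R = {}" using \<eta> by (auto simp: F_def void_event_def)
      then have sub: "\<eta> \<inter> {0..b} \<subseteq> y ` S" using y by fastforce
      have inj: "inj_on y S"
      proof (rule inj_onI)
        fix x x' assume *: "x \<in> S" "x' \<in> S" "y x = y x'"
        then have "\<bar>x' - x\<bar> < 2 * d" using y'(2)[of x] y'(2)[of x'] by auto
        then show "x = x'" using d(2)[of x x'] * ST by force
      qed
      have "(\<integral>x. f x \<partial>config_measure half_line \<eta>) = (\<Sum>z\<in>\<eta> \<inter> {0..b}. f z)"
        by (rule int_eq[OF conf])
      also have "\<dots> = (\<Sum>z\<in>y ` S. f z)"
      proof (rule sum.mono_neutral_left)
        show "\<forall>z\<in>y ` S - \<eta> \<inter> {0..b}. f z = 0"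
          using y'(1) fb configurationsD(1)[OF conf] by blast
      qed (use S sub in auto)
      also have "\<dots> = (\<Sum>x\<in>S. f (y x))" using inj by (simp add: sum.reindex)
      finally have int: "(\<integral>x. f x \<partial>config_measure half_line \<eta>) = (\<Sum>x\<in>S. f (y x))" .
      have "\<bar>f (y x) - f x\<bar> \<le> e'" if "x \<in> S" for x
        using d(1)[OF that _ y'(2)[OF that]] y'(1)[OF that] configurationsD(1)[OF conf] by force
      then have "(\<Sum>x\<in>S. \<bar>f (y x) - f x\<bar>) \<le> real (card S) * e'"
        by (rule sum_bounded_above)
      also have "\<dots> < e" using e(1) by (simp add: e'_def field_simps)
      finally have "\<bar>\<Sum>x\<in>S. f (y x) - f x\<bar> < e" by (rule le_less_trans[OF sum_abs])
      then show "\<eta> \<in> {\<omega> \<in> configurations half_line. (\<integral>x. f x \<partial>config_measure half_line \<omega>) \<in> V}"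
        using conf e(2) by (simp add: int dist_real_def sum_subtractf)
    qed
  qed
qed

text \<open>A vaguely open set is a union of finite intersections of cell events, and there are only
  countably many of these. The topology itself is given by a subbasis, hence the induction over
  the generation of open sets.\<close>

lemma openin_vague_imp_void_algebra:
  assumes "openin (vague_topology half_line) W"
  shows "W \<in> void_algebra"
proof -
  have nhd: "\<exists>F. finite F \<and> F \<subseteq> cell_events \<and> \<omega> \<in> \<Inter>F \<and> configurations half_line \<inter> \<Inter>F \<subseteq> W"
    if "\<omega> \<in> W" for \<omega>
    using assms that unfolding vague_topology_def openin_topology_generated_by_iff
  proof (induction arbitrary: \<omega>)
    case (Int W\<^sub>1 W\<^sub>2)
    then have "\<omega> \<in> W\<^sub>1" "\<omega> \<in> W\<^sub>2" by auto
    from Int.IH(1)[OF this(1)] obtain F\<^sub>1 where F\<^sub>1: "finite F\<^sub>1" "F\<^sub>1 \<subseteq> cell_events"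
      "\<omega> \<in> \<Inter>F\<^sub>1" "configurations half_line \<inter> \<Inter>F\<^sub>1 \<subseteq> W\<^sub>1" by blast
    from Int.IH(2)[OF \<open>\<omega> \<in> W\<^sub>2\<close>] obtain F\<^sub>2 where F\<^sub>2: "finite F\<^sub>2" "F\<^sub>2 \<subseteq> cell_events"
      "\<omega> \<in> \<Inter>F\<^sub>2" "configurations half_line \<inter> \<Inter>F\<^sub>2 \<subseteq> W\<^sub>2" by blast
    show ?case
      using F\<^sub>1 F\<^sub>2 by (intro exI[of _ "F\<^sub>1 \<union> F\<^sub>2"]) (simp only: Inf_union_distrib finite_Un, blast)
  next
    case (UN \<W>)
    then obtain k where k: "k \<in> \<W>" "\<omega> \<in> k" by blast
    from UN.IH[OF k] obtain F where F: "finite F" "F \<subseteq> cell_events" "\<omega> \<in> \<Inter>F"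
      "configurations half_line \<inter> \<Inter>F \<subseteq> k" by blast
    have "configurations half_line \<inter> \<Inter>F \<subseteq> \<Union>\<W>" by (rule order_trans[OF F(4) Union_upper[OF k(1)]])
    with F(1-3) show ?case by (intro exI[of _ F] conjI)
  next
    case (Basis s)
    then obtain f V where f: "test_function half_line f" and V: "open V"
      and s: "s = {\<omega> \<in> configurations half_line. (\<integral>x. f x \<partial>config_measure half_line \<omega>) \<in> V}"
      by blast
    have "\<omega> \<in> configurations half_line" "(\<integral>x. f x \<partial>config_measure half_line \<omega>) \<in> V"
      using Basis(2) unfolding s by simp_all
    from vague_subbasis_cell_events[OF f V this] obtain F where "finite F" "F \<subseteq> cell_events"
      "\<omega> \<in> \<Inter>F" "configurations half_line \<inter> \<Inter>F \<subseteq> s" unfolding s .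
    then show ?case by (intro exI[of _ F] conjI)
  qed simp
  define \<F> where "\<F> = {F. finite F \<and> F \<subseteq> cell_events \<and> configurations half_line \<inter> \<Inter>F \<subseteq> W}"
  have "W = (\<Union>F\<in>\<F>. configurations half_line \<inter> \<Inter>F)"
  proof (intro equalityI subsetI)
    fix \<omega> assume \<omega>: "\<omega> \<in> W"
    from nhd[OF this] obtain F where "F \<in> \<F>" "\<omega> \<in> \<Inter>F" unfolding \<F>_def by auto
    moreover have "\<omega> \<in> configurations half_line" using \<omega> openin_vague_subset[OF assms] by (rule subsetD[rotated])
    ultimately show "\<omega> \<in> (\<Union>F\<in>\<F>. configurations half_line \<inter> \<Inter>F)" by (intro UN_I IntI)
  next
    fix \<omega> assume "\<omega> \<in> (\<Union>F\<in>\<F>. configurations half_line \<inter> \<Inter>F)"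
    then obtain F where "F \<in> \<F>" "\<omega> \<in> configurations half_line \<inter> \<Inter>F" by (rule UN_E)
    then show "\<omega> \<in> W" unfolding \<F>_def mem_Collect_eq by (elim conjE subsetD)
  qed
  moreover have "countable \<F>"
    by (rule countable_subset[OF _ countable_Collect_finite_subset[OF countable_cell_events]])
      (auto simp: \<F>_def)
  moreover have "configurations half_line \<inter> \<Inter>F \<in> void_algebra" if "F \<in> \<F>" for F
  proof -
    have "finite F" "F \<subseteq> void_algebra" using that cell_events_subset by (auto simp: \<F>_def)
    then show ?thesis
    proof (induction F)
      case empty
      show ?case using sigma_sets_top by simp
    next
      case (insert A F)
      interpret algebra: sigma_algebra "configurations half_line" void_algebra
        by (rule sigma_algebra_void_algebra)
      from insert have "A \<inter> (configurations half_line \<inter> \<Inter>F) \<in> void_algebra"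
        by (simp only: algebra.Int insert_subset)
      then show ?case by (simp add: Int_left_commute)
    qed
  qed
  ultimately show ?thesis
    by (simp only: sigma_algebra.countable_UN''[OF sigma_algebra_void_algebra])
qed

lemma sets_config_borel_half_line: "sets (config_borel half_line) = void_algebra"
proof
  show "sets (config_borel half_line) \<subseteq> void_algebra"
    unfolding sets_config_borel
    by (rule sigma_algebra.sigma_sets_subset[OF sigma_algebra_void_algebra])
      (auto intro: openin_vague_imp_void_algebra)
  have "void_algebra \<subseteq> sigma_sets (space (config_borel half_line)) (sets (config_borel half_line))"
    unfolding space_config_borel
    by (rule sigma_sets_mono') (auto intro: sets_void_event)
  then show "void_algebra \<subseteq> sets (config_borel half_line)"
    unfolding sets.sigma_sets_eq .
qed

text \<open>Both laws agree on the void events of compact sets, which are stable under intersection since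
  avoiding \<open>K\<close> and \<open>K'\<close> means avoiding \<open>K \<union> K'\<close>.\<close>

lemma law_eq_if_laplace_eq:
  assumes P: "prob_space P" "sets P = sets (config_borel half_line)"
    and Q: "prob_space Q" "sets Q = sets (config_borel half_line)"
    and laplace: "\<And>f. test_function half_line f \<Longrightarrow>
        (\<integral>\<omega>. exp (\<integral>x. f x \<partial>config_measure half_line \<omega>) \<partial>P) =
        (\<integral>\<omega>. exp (\<integral>x. f x \<partial>config_measure half_line \<omega>) \<partial>Q)"
  shows "P = Q"
proof (rule measure_eqI_generator_eq[where A = "\<lambda>_. void_event half_line {}"])
  let ?E = "{void_event half_line K | K. compact K \<and> K \<subseteq> half_line}"
  interpret P: prob_space P by fact
  interpret Q: prob_space Q by fact
  have sp: "space P = configurations half_line" "space Q = configurations half_line"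
    using sets_eq_imp_space_eq[OF P(2)] sets_eq_imp_space_eq[OF Q(2)] by simp_all
  show "Int_stable ?E"
  proof (rule Int_stableI, clarify)
    fix K K' :: "real set" assume "compact K" "K \<subseteq> half_line" "compact K'" "K' \<subseteq> half_line"
    moreover have "void_event half_line K \<inter> void_event half_line K' = void_event half_line (K \<union> K')"
      by (auto simp: void_event_def)
    ultimately show "\<exists>L. void_event half_line K \<inter> void_event half_line K' = void_event half_line L \<and>
       compact L \<and> L \<subseteq> half_line" by blast
  qed
  show "?E \<subseteq> Pow (configurations half_line)" by (auto simp: void_event_def)
  show "sets P = void_algebra" "sets Q = void_algebra"
    by (simp_all add: P Q sets_config_borel_half_line)
  show "emeasure P A = emeasure Q A" if "A \<in> ?E" for A
  proof -
    obtain K where A: "A = void_event half_line K" and K: "compact K" "K \<subseteq> half_line"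
      using \<open>A \<in> ?E\<close> by blast
    show ?thesis
    proof (cases "K = {}")
      case True
      then show ?thesis
        using P.emeasure_space_1 Q.emeasure_space_1 by (simp add: A void_event_empty sp)
    next
      case False
      have "measure P A = measure Q A"
        unfolding A
      proof (rule LIMSEQ_unique[OF prob_void_event[OF closed_atLeast K False P]])
        show "(\<lambda>n. \<integral>\<omega>. exp (\<integral>x. - real n * bump K n x \<partial>config_measure half_line \<omega>) \<partial>P)
          \<longlonglongrightarrow> measure Q (void_event half_line K)"
          unfolding laplace[OF test_function_bump[OF closed_atLeast K False]]
          by (rule prob_void_event[OF closed_atLeast K False Q])
      qed
      then show ?thesis by (simp add: P.emeasure_eq_measure Q.emeasure_eq_measure)
    qed
  qed
  show "range (\<lambda>_. void_event half_line {}) \<subseteq> ?E" by (auto intro!: exI[of _ "{}"])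
  show "emeasure P (void_event half_line {}) \<noteq> \<infinity>" for i :: nat by simp
qed (auto simp: void_event_empty)

section \<open>Campbell's inequality\<close>

text \<open>Campbell's formula is the derivative at \<open>t = 0\<close> of the Laplace functional of \<open>t f\<close>. For the upper
  bound no differentiation under the integral is needed: \<open>N \<le> (exp (t N) - 1) / t\<close> has a mean
  that the Laplace functional gives exactly, and \<open>exp u - 1 \<le> u exp u\<close> bounds the exponent.\<close>

lemma poisson_campbell_test_function:
  assumes P: "poisson_measure X \<sigma> P" and \<sigma>: "sets \<sigma> = sets (restrict_space borel X)"
    and f: "test_function X f" and nonneg: "\<And>x. x \<in> X \<Longrightarrow> 0 \<le> f x" and M: "\<And>x. x \<in> X \<Longrightarrow> f x \<le> M"
    and int: "integrable \<sigma> f"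
  shows "(\<integral>\<^sup>+\<omega>. ennreal (\<integral>x. f x \<partial>config_measure X \<omega>) \<partial>P) \<le> ennreal (\<integral>x. f x \<partial>\<sigma>)"
proof -
  note P' = poisson_measureD[OF P]
  have sp: "space \<sigma> = X" using sets_eq_imp_space_eq[OF \<sigma>] by (simp add: space_restrict_space)
  define c where "c = (\<integral>x. f x \<partial>\<sigma>)"
  define N where "N \<omega> = (\<integral>x. f x \<partial>config_measure X \<omega>)" for \<omega>
  have fm[measurable]: "f \<in> borel_measurable \<sigma>" using int by auto
  have N_meas[measurable]: "N \<in> borel_measurable P"
    using measurable_integral_config_measure[OF f] unfolding N_def
    by (simp add: measurable_cong_sets[OF P'(2) refl])
  have bound: "(\<integral>\<^sup>+\<omega>. ennreal (N \<omega>) \<partial>P) \<le> ennreal ((exp (t * (exp (t * M) * c)) - 1) / t)"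
    if t: "0 < t" for t
  proof -
    let ?g = "\<lambda>x. exp (t * f x) - 1"
    have tf: "test_function X (\<lambda>x. t * f x)"
      using f by (auto simp: test_function_def intro!: continuous_intros)
    have laplace: "(\<integral>\<omega>. exp (t * N \<omega>) \<partial>P) = exp (\<integral>x. ?g x \<partial>\<sigma>)"
      using P'(4)[OF tf] by (simp add: N_def)
    have g_le: "?g x \<le> t * exp (t * M) * f x" if "x \<in> X" for x
    proof -
      have "1 - t * f x \<le> exp (- (t * f x))" using exp_ge_add_one_self[of "- (t * f x)"] by simp
      then have "exp (t * f x) * (1 - t * f x) \<le> exp (t * f x) * exp (- (t * f x))"
        by (intro mult_left_mono) auto
      then have "?g x \<le> exp (t * f x) * (t * f x)"
        by (simp add: exp_minus algebra_simps)
      also have "\<dots> \<le> exp (t * M) * (t * f x)"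
        using M[OF that] nonneg[OF that] t by (intro mult_right_mono) auto
      finally show ?thesis by (simp add: algebra_simps)
    qed
    have g_int: "integrable \<sigma> ?g"
    proof (rule Bochner_Integration.integrable_bound)
      show "integrable \<sigma> (\<lambda>x. t * exp (t * M) * f x)" using int by simp
      show "AE x in \<sigma>. norm (?g x) \<le> norm (t * exp (t * M) * f x)"
        using g_le nonneg t by (intro AE_I2) (auto simp: sp abs_mult)
    qed measurable
    have "(\<integral>x. ?g x \<partial>\<sigma>) \<le> (\<integral>x. t * exp (t * M) * f x \<partial>\<sigma>)"
      using g_le int g_int by (intro integral_mono) (auto simp: sp)
    also have "\<dots> = t * (exp (t * M) * c)" by (simp add: c_def)
    finally have le: "(\<integral>x. ?g x \<partial>\<sigma>) \<le> t * (exp (t * M) * c)" .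
    interpret prob_space P by (rule P')
    \<comment> \<open>The Bochner integral of a non-integrable function is \<open>0\<close>, which is not a value of \<open>exp\<close>.\<close>
    have exp_int: "integrable P (\<lambda>\<omega>. exp (t * N \<omega>))"
      using laplace not_integrable_integral_eq[of P "\<lambda>\<omega>. exp (t * N \<omega>)"] by fastforce
    have "(\<integral>\<^sup>+\<omega>. ennreal (N \<omega>) \<partial>P) \<le> (\<integral>\<^sup>+\<omega>. ennreal ((exp (t * N \<omega>) - 1) / t) \<partial>P)"
    proof (intro nn_integral_mono ennreal_leI)
      fix \<omega>
      show "N \<omega> \<le> (exp (t * N \<omega>) - 1) / t"
        using exp_ge_add_one_self[of "t * N \<omega>"] t by (simp add: field_simps)
    qed
    also have "\<dots> = ennreal (\<integral>\<omega>. (exp (t * N \<omega>) - 1) / t \<partial>P)"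
    proof (rule nn_integral_eq_integral)
      show "integrable P (\<lambda>\<omega>. (exp (t * N \<omega>) - 1) / t)" using exp_int by simp
      have "0 \<le> N \<omega>" if "\<omega> \<in> space P" for \<omega>
        unfolding N_def using nonneg that configurationsD(1)[of \<omega> X]
        by (intro integral_config_measure_nonneg) (auto simp: P'(3))
      then show "AE \<omega> in P. 0 \<le> (exp (t * N \<omega>) - 1) / t"
        using t by (intro AE_I2) auto
    qed
    also have "(\<integral>\<omega>. (exp (t * N \<omega>) - 1) / t \<partial>P) = (exp (\<integral>x. ?g x \<partial>\<sigma>) - 1) / t"
      using exp_int by (simp add: laplace prob_space)
    also have "ennreal \<dots> \<le> ennreal ((exp (t * (exp (t * M) * c)) - 1) / t)"
      using t le by (intro ennreal_leI divide_right_mono) auto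
    finally show ?thesis .
  qed
  have "((\<lambda>t. (exp (t * (exp (t * M) * c)) - 1) / t) \<longlongrightarrow> c) (at_right 0)"
  proof -
    have "((\<lambda>t. exp (t * (exp (t * M) * c))) has_real_derivative c) (at 0)"
      by (auto intro!: derivative_eq_intros)
    then have "((\<lambda>t. (exp (t * (exp (t * M) * c)) - 1) / t) \<longlongrightarrow> c) (at 0)"
      by (simp add: DERIV_def)
    then show ?thesis by (rule filterlim_mono[OF _ order_refl at_le]) auto
  qed
  then have "((\<lambda>t. ennreal ((exp (t * (exp (t * M) * c)) - 1) / t)) \<longlongrightarrow> ennreal c) (at_right 0)"
    by (rule tendsto_ennrealI)
  then have "(\<integral>\<^sup>+\<omega>. ennreal (N \<omega>) \<partial>P) \<le> ennreal c"
    by (rule tendsto_lowerbound)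
      (auto intro!: bound simp: eventually_at_right_field intro: exI[of _ 1])
  then show ?thesis by (simp add: N_def c_def)
qed

definition cutoff :: "nat \<Rightarrow> real \<Rightarrow> real" where
  "cutoff n x = max 0 (min 1 (real n - x))"

lemma cutoff_bounds: "0 \<le> cutoff n x" "cutoff n x \<le> 1"
  by (auto simp: cutoff_def)

lemma cutoff_mono: "m \<le> n \<Longrightarrow> cutoff m x \<le> cutoff n x"
  by (auto simp: cutoff_def)

lemma SUP_cutoff:
  assumes "0 \<le> a"
  shows "(SUP n. ennreal (a * cutoff n x)) = ennreal a"
proof (rule antisym)
  show "(SUP n. ennreal (a * cutoff n x)) \<le> ennreal a"
    using assms cutoff_bounds by (intro SUP_least ennreal_leI mult_right_le_one_le)
  obtain n where "x + 1 \<le> real n" using real_arch_simple by blast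
  then have "cutoff n x = 1" by (simp add: cutoff_def)
  then show "ennreal a \<le> (SUP n. ennreal (a * cutoff n x))"
    by (intro SUP_upper2[of n]) auto
qed

lemma test_function_cutoff:
  assumes "continuous_on half_line g"
  shows "test_function half_line (\<lambda>x. g x * cutoff n x)"
  unfolding test_function_def
proof (intro conjI exI)
  show "continuous_on half_line (\<lambda>x. g x * cutoff n x)"
    unfolding cutoff_def by (intro continuous_intros assms)
  show "compact {0..real n}" "{0..real n} \<subseteq> half_line" by auto
  show "\<forall>x\<in>half_line - {0..real n}. g x * cutoff n x = 0" by (auto simp: cutoff_def)
qed

text \<open>Both statements follow from test functions by monotone convergence along the cutoffs of \<open>g\<close>.\<close>

lemma
  assumes g: "continuous_on half_line g" and nonneg: "\<And>x. x \<in> half_line \<Longrightarrow> 0 \<le> g x"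
  shows measurable_nn_integral_config_measure:
      "(\<lambda>\<omega>. \<integral>\<^sup>+x. ennreal (g x) \<partial>config_measure half_line \<omega>) \<in> borel_measurable (config_borel half_line)"
    and poisson_campbell: "poisson_measure half_line \<sigma> P \<Longrightarrow> sets \<sigma> = sets (restrict_space borel half_line) \<Longrightarrow>
      (\<integral>\<^sup>+\<omega>. (\<integral>\<^sup>+x. ennreal (g x) \<partial>config_measure half_line \<omega>) \<partial>P) \<le> (\<integral>\<^sup>+x. ennreal (g x) \<partial>\<sigma>)"
proof -
  define N where "N n \<omega> = ennreal (\<integral>x. g x * cutoff n x \<partial>config_measure half_line \<omega>)" for n \<omega>
  note tf = test_function_cutoff[OF g]
  have sup: "(\<integral>\<^sup>+x. ennreal (g x) \<partial>config_measure half_line \<omega>) = (SUP n. N n \<omega>)"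
    and inc: "incseq (\<lambda>n. N n \<omega>)"
    if \<omega>: "\<omega> \<in> configurations half_line" for \<omega>
  proof -
    have sp: "space (config_measure half_line \<omega>) = half_line"
      "sets (config_measure half_line \<omega>) = sets (restrict_space borel half_line)"
      by (simp_all add: config_measure_def space_restrict_space)
    have N: "N n \<omega> = (\<integral>\<^sup>+x. ennreal (g x * cutoff n x) \<partial>config_measure half_line \<omega>)" for n
      unfolding N_def using nonneg cutoff_bounds
      by (intro nn_integral_config_measure_test_function[OF \<omega> tf, symmetric]) auto
    have meas: "(\<lambda>x. ennreal (g x * cutoff n x)) \<in> borel_measurable (config_measure half_line \<omega>)" for n
      using test_function_measurable[OF tf, of n] by (simp add: measurable_cong_sets[OF sp(2) refl])
    have mono: "ennreal (g x * cutoff m x) \<le> ennreal (g x * cutoff n x)" if "x \<in> half_line" "m \<le> n" for m n x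
      using that nonneg cutoff_mono by (intro ennreal_leI mult_left_mono) auto
    show "incseq (\<lambda>n. N n \<omega>)"
      unfolding N incseq_def using mono by (auto intro!: nn_integral_mono simp: sp)
    have "(\<integral>\<^sup>+x. ennreal (g x) \<partial>config_measure half_line \<omega>)
        = (\<integral>\<^sup>+x. (SUP n. ennreal (g x * cutoff n x)) \<partial>config_measure half_line \<omega>)"
      using nonneg by (intro nn_integral_cong) (simp add: SUP_cutoff sp)
    also have "\<dots> = (SUP n. \<integral>\<^sup>+x. ennreal (g x * cutoff n x) \<partial>config_measure half_line \<omega>)"
      using mono by (intro nn_integral_monotone_convergence_SUP_AE meas AE_I2) (auto simp: sp)
    finally show "(\<integral>\<^sup>+x. ennreal (g x) \<partial>config_measure half_line \<omega>) = (SUP n. N n \<omega>)"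
      unfolding N .
  qed
  have N_meas: "N n \<in> borel_measurable (config_borel half_line)" for n
    unfolding N_def using measurable_integral_config_measure[OF tf, of n] by measurable
  show "(\<lambda>\<omega>. \<integral>\<^sup>+x. ennreal (g x) \<partial>config_measure half_line \<omega>) \<in> borel_measurable (config_borel half_line)"
    by (subst measurable_cong[OF sup]) (use N_meas in auto)
  assume P: "poisson_measure half_line \<sigma> P" and \<sigma>: "sets \<sigma> = sets (restrict_space borel half_line)"
  note P' = poisson_measureD[OF P]
  have sp: "space \<sigma> = half_line" using sets_eq_imp_space_eq[OF \<sigma>] by (simp add: space_restrict_space)
  have meas: "(\<lambda>x. g x * cutoff n x) \<in> borel_measurable \<sigma>" for n
    using test_function_measurable[OF tf, of n] by (simp add: measurable_cong_sets[OF \<sigma> refl])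
  have le: "(\<integral>\<^sup>+\<omega>. N n \<omega> \<partial>P) \<le> (\<integral>\<^sup>+x. ennreal (g x) \<partial>\<sigma>)" for n
  proof (cases "(\<integral>\<^sup>+x. ennreal (g x) \<partial>\<sigma>) = \<infinity>")
    case False
    have le_g: "(\<integral>\<^sup>+x. ennreal (g x * cutoff n x) \<partial>\<sigma>) \<le> (\<integral>\<^sup>+x. ennreal (g x) \<partial>\<sigma>)"
      using nonneg cutoff_bounds
      by (intro nn_integral_mono ennreal_leI mult_right_le_one_le) (auto simp: sp)
    have pos: "0 \<le> g x * cutoff n x" if "x \<in> half_line" for x using that nonneg cutoff_bounds by simp
    have int: "integrable \<sigma> (\<lambda>x. g x * cutoff n x)"
      using False le_g pos
      by (intro integrableI_nonneg meas AE_I2) (auto simp: sp less_top top_unique)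
    have "compact ((\<lambda>x. g x) ` {0..real n})"
      by (rule compact_continuous_image) (auto intro: continuous_on_subset[OF g])
    then obtain M where M: "\<And>x. x \<in> {0..real n} \<Longrightarrow> \<bar>g x\<bar> \<le> M"
      using compact_imp_bounded[of "g ` {0..real n}"] unfolding bounded_iff by (auto simp del: atLeastAtMost_iff)
    have "g x * cutoff n x \<le> max 0 M" if "x \<in> half_line" for x
    proof (cases "x \<le> real n")
      case True
      have "g x * cutoff n x \<le> g x"
        using that nonneg cutoff_bounds by (intro mult_right_le_one_le) auto
      also have "g x \<le> M" using M[of x] that True by auto
      finally show ?thesis by simp
    qed (simp add: cutoff_def)
    from poisson_campbell_test_function[OF P \<sigma> tf pos this int]
    have "(\<integral>\<^sup>+\<omega>. N n \<omega> \<partial>P) \<le> ennreal (\<integral>x. g x * cutoff n x \<partial>\<sigma>)" by (simp add: N_def)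
    also have "\<dots> = (\<integral>\<^sup>+x. ennreal (g x * cutoff n x) \<partial>\<sigma>)"
      using int pos by (intro nn_integral_eq_integral[symmetric] AE_I2) (auto simp: sp)
    finally show ?thesis using le_g by (rule order_trans)
  qed simp
  have "(\<integral>\<^sup>+\<omega>. (\<integral>\<^sup>+x. ennreal (g x) \<partial>config_measure half_line \<omega>) \<partial>P) = (\<integral>\<^sup>+\<omega>. (SUP n. N n \<omega>) \<partial>P)"
    using sup by (intro nn_integral_cong) (simp add: P')
  also have "\<dots> = (SUP n. \<integral>\<^sup>+\<omega>. N n \<omega> \<partial>P)"
    using inc N_meas
    by (intro nn_integral_monotone_convergence_SUP_AE AE_I2)
      (auto simp: P' measurable_cong_sets[OF P'(2) refl] incseq_def)
  also have "\<dots> \<le> (\<integral>\<^sup>+x. ennreal (g x) \<partial>\<sigma>)" by (intro SUP_least le)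
  finally show "(\<integral>\<^sup>+\<omega>. (\<integral>\<^sup>+x. ennreal (g x) \<partial>config_measure half_line \<omega>) \<partial>P) \<le> (\<integral>\<^sup>+x. ennreal (g x) \<partial>\<sigma>)" .
qed

section \<open>Transporting configurations\<close>

text \<open>For measurable \<open>f\<close> this is the transformation formula. The inequality holds for every \<open>f\<close>, as the
  integral of a non-measurable function is the supremum over the measurable ones below it; it is
  applied to the Wasserstein distance, an infimum over uncountably many couplings.\<close>

lemma nn_integral_distr_le:
  assumes T: "T \<in> M \<rightarrow>\<^sub>M N"
  shows "(\<integral>\<^sup>+y. f y \<partial>distr M N T) \<le> (\<integral>\<^sup>+x. f (T x) \<partial>M)"
  unfolding nn_integral_def[of "distr M N T"]
proof (rule SUP_least, clarify)
  fix s assume s: "simple_function (distr M N T) s" "s \<le> f"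
  have "integral\<^sup>S (distr M N T) s = (\<integral>\<^sup>+y. s y \<partial>distr M N T)"
    by (rule nn_integral_eq_simple_integral[OF s(1), symmetric])
  also have "\<dots> = (\<integral>\<^sup>+x. s (T x) \<partial>M)"
    using borel_measurable_simple_function[OF s(1)] by (intro nn_integral_distr T) simp
  also have "\<dots> \<le> (\<integral>\<^sup>+x. f (T x) \<partial>M)"
    using s(2) by (intro nn_integral_mono) (auto simp: le_fun_def)
  finally show "integral\<^sup>S (distr M N T) s \<le> (\<integral>\<^sup>+x. f (T x) \<partial>M)" .
qed

text \<open>The inequality of arithmetic and geometric means for \<open>z / a\<close> and \<open>a\<close>. Integrating this bound, which
  is affine in \<open>z\<close>, and then optimising over \<open>a\<close> gives Jensen's inequality for the square root.\<close>

lemma ennreal_sqrt_le: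
  assumes "0 < a"
  shows "ennreal_sqrt z \<le> ennreal (1 / (2 * a)) * z + ennreal (a / 2)"
proof (cases z)
  case (real r)
  have "0 \<le> (sqrt r - a)\<^sup>2" by simp
  then have "2 * a * sqrt r \<le> r + a\<^sup>2" using real by (simp add: power2_diff algebra_simps)
  then have "sqrt r \<le> 1 / (2 * a) * r + a / 2"
    using assms by (simp add: field_simps power2_eq_square)
  moreover have "ennreal (1 / (2 * a)) * z + ennreal (a / 2) = ennreal (1 / (2 * a) * r + a / 2)"
    using real assms by (simp add: ennreal_mult[symmetric])
  ultimately show ?thesis using real by (simp add: ennreal_sqrt_def ennreal_leI)
next
  case top
  then show ?thesis using assms by (simp add: ennreal_mult_top)
qed

lemma measurable_restrict_borel_continuous_on:
  assumes "continuous_on X h" "h ` X \<subseteq> Y"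
  shows "h \<in> restrict_space borel X \<rightarrow>\<^sub>M restrict_space borel Y"
  using assms
  by (intro measurable_restrict_space2 borel_measurable_continuous_on_restrict)
    (auto simp: space_restrict_space)

lemma config_measure_image:
  assumes "\<omega> \<subseteq> X" "inj_on h \<omega>" and h: "h \<in> restrict_space borel X \<rightarrow>\<^sub>M restrict_space borel Y"
  shows "config_measure Y (h ` \<omega>) = distr (config_measure X \<omega>) (restrict_space borel Y) h"
proof -
  have sub: "h ` \<omega> \<subseteq> Y"
    using measurable_space[OF h] assms(1) by (auto simp: space_restrict_space)
  have "config_measure Y (h ` \<omega>)
      = distr (distr (count_space \<omega>) (count_space (h ` \<omega>)) h) (restrict_space borel Y) (\<lambda>x. x)"
    unfolding config_measure_def using distr_bij_count_space[OF inj_on_imp_bij_betw[OF assms(2)]] by simp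
  also have "\<dots> = distr (count_space \<omega>) (restrict_space borel Y) h"
    using measurable_count_space_restrict_borel[OF sub] by (subst distr_distr) (auto simp: comp_def)
  also have "\<dots> = distr (config_measure X \<omega>) (restrict_space borel Y) h"
    unfolding config_measure_def
    using measurable_count_space_restrict_borel[OF assms(1)] h by (subst distr_distr) (auto simp: comp_def)
  finally show ?thesis .
qed

text \<open>The cost of the coupling that matches each \<open>\<phi> x\<close> with \<open>x\<close>. Injectivity makes each point of the
  image come from one point of \<open>\<omega>\<close>, so that the first marginal is the configuration \<open>\<phi> ` \<omega>\<close>
  without multiplicities.\<close>

lemma wasserstein_dist_image_le:
  fixes X :: "'a::{metric_space, second_countable_topology} set"
  assumes \<omega>: "\<omega> \<in> configurations X" and inj: "inj_on \<phi> X" and maps: "\<phi> ` X \<subseteq> X"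
    and cont: "continuous_on X \<phi>"
  shows "wasserstein_dist X (\<phi> ` \<omega>) \<omega>
    \<le> ennreal_sqrt (\<integral>\<^sup>+x. ennreal ((dist (\<phi> x) x)\<^sup>2) \<partial>config_measure X \<omega>)"
proof -
  define h where "h x = (\<phi> x, x)" for x
  note sub = configurationsD(1)[OF \<omega>]
  have h: "h \<in> restrict_space borel X \<rightarrow>\<^sub>M restrict_space borel (X \<times> X)"
    unfolding h_def using maps
    by (intro measurable_restrict_borel_continuous_on continuous_intros cont) auto
  have \<phi>: "\<phi> \<in> restrict_space borel X \<rightarrow>\<^sub>M restrict_space borel X"
    by (intro measurable_restrict_borel_continuous_on cont maps)
  have "inj_on h \<omega>" by (auto simp: h_def inj_on_def)
  note \<beta> = config_measure_image[OF sub this h]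
  have fst_snd: "fst \<in> restrict_space borel (X \<times> X) \<rightarrow>\<^sub>M restrict_space borel X"
    "snd \<in> restrict_space borel (X \<times> X) \<rightarrow>\<^sub>M restrict_space borel X"
    by (auto intro!: measurable_restrict_borel_continuous_on continuous_intros)
  have sets_conf: "sets (config_measure X \<omega>) = sets (restrict_space borel X)"
    by (simp add: config_measure_def)
  have h': "h \<in> config_measure X \<omega> \<rightarrow>\<^sub>M restrict_space borel (X \<times> X)"
    using h by (simp add: measurable_cong_sets[OF sets_conf refl])
  have "h ` \<omega> \<in> config_couplings X (\<phi> ` \<omega>) \<omega>"
    unfolding config_couplings_def
  proof (intro CollectI conjI)
    show "h ` \<omega> \<in> configurations (X \<times> X)"
      unfolding configurations_def
    proof (intro CollectI conjI allI impI)
      show "h ` \<omega> \<subseteq> X \<times> X" using sub maps by (auto simp: h_def)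
      fix K assume K: "compact K \<and> K \<subseteq> X \<times> X"
      have "compact (snd ` K)" using K by (intro compact_continuous_image continuous_intros) auto
      then have "finite (\<omega> \<inter> snd ` K)" using K by (intro configurationsD(2)[OF \<omega>]) auto
      moreover have "h ` \<omega> \<inter> K \<subseteq> h ` (\<omega> \<inter> snd ` K)" by (force simp: h_def)
      ultimately show "finite (h ` \<omega> \<inter> K)" by (meson finite_imageI finite_subset)
    qed
    show "distr (config_measure (X \<times> X) (h ` \<omega>)) (restrict_space borel X) fst = config_measure X (\<phi> ` \<omega>)"
      unfolding \<beta> distr_distr[OF fst_snd(1) h']
      using config_measure_image[OF sub inj_on_subset[OF inj sub] \<phi>] by (simp add: comp_def h_def)
    show "distr (config_measure (X \<times> X) (h ` \<omega>)) (restrict_space borel X) snd = config_measure X \<omega>"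
      unfolding \<beta> distr_distr[OF fst_snd(2) h']
      using config_measure_image[OF sub inj_on_id2, of X] by (simp add: comp_def h_def)
  qed
  then have "wasserstein_dist X (\<phi> ` \<omega>) \<omega> \<le>
      ennreal_sqrt (\<integral>\<^sup>+z. ennreal ((dist (fst z) (snd z))\<^sup>2) \<partial>config_measure (X \<times> X) (h ` \<omega>))"
    unfolding wasserstein_dist_def by (rule INF_lower)
  also have "(\<integral>\<^sup>+z. ennreal ((dist (fst z) (snd z))\<^sup>2) \<partial>config_measure (X \<times> X) (h ` \<omega>))
      = (\<integral>\<^sup>+x. ennreal ((dist (\<phi> x) x)\<^sup>2) \<partial>config_measure X \<omega>)"
    unfolding \<beta>
  proof (subst nn_integral_distr[OF h'])
    have "(\<lambda>z. (dist (fst z) (snd z))\<^sup>2) \<in> borel_measurable (restrict_space borel (X \<times> X))"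
      by (intro borel_measurable_continuous_on_restrict continuous_intros)
    then show "(\<lambda>z. ennreal ((dist (fst z) (snd z))\<^sup>2)) \<in>
        borel_measurable (distr (config_measure X \<omega>) (restrict_space borel (X \<times> X)) h)" by simp
  qed (simp add: h_def)
  finally show ?thesis .
qed

lemma compact_preimage_half_line:
  fixes \<phi> :: "real \<Rightarrow> real"
  assumes cont: "continuous_on half_line \<phi>" and proper: "filterlim \<phi> at_top at_top" and K: "compact K"
  shows "compact {x \<in> half_line. \<phi> x \<in> K}"
proof -
  obtain B where B: "\<And>y. y \<in> K \<Longrightarrow> \<bar>y\<bar> \<le> B"
    using compact_imp_bounded[OF K] by (auto simp: bounded_iff)
  obtain b where b: "\<And>x. b \<le> x \<Longrightarrow> B < \<phi> x"
    using proper unfolding filterlim_at_top_dense eventually_at_top_linorder by blast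
  have "closed (half_line \<inter> \<phi> -` K)"
    using cont compact_imp_closed[OF K] by (intro continuous_closed_preimage) auto
  moreover have "half_line \<inter> \<phi> -` K \<subseteq> {0..b}"
  proof
    fix x assume x: "x \<in> half_line \<inter> \<phi> -` K"
    then have "\<phi> x \<le> B" using B[of "\<phi> x"] by simp
    then have "\<not> b \<le> x" using b[of x] by linarith
    then show "x \<in> {0..b}" using x by simp
  qed
  ultimately have "compact (half_line \<inter> \<phi> -` K)"
    using compact_Int_closed[of "{0..b}" "half_line \<inter> \<phi> -` K"] by (simp add: Int_absorb1)
  moreover have "half_line \<inter> \<phi> -` K = {x \<in> half_line. \<phi> x \<in> K}" by auto
  ultimately show ?thesis by simp
qed

text \<open>Properness of \<open>\<phi>\<close> is what keeps images of configurations locally finite and supports of test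
  functions compact.\<close>

context
  fixes \<phi> :: "real \<Rightarrow> real"
  assumes cont: "continuous_on half_line \<phi>" and proper: "filterlim \<phi> at_top at_top"
    and maps: "\<phi> ` half_line \<subseteq> half_line" and inj: "inj_on \<phi> half_line"
begin

lemma image_in_configurations:
  assumes \<omega>: "\<omega> \<in> configurations half_line"
  shows "\<phi> ` \<omega> \<in> configurations half_line"
  unfolding configurations_def
proof (intro CollectI conjI allI impI)
  note sub = configurationsD(1)[OF \<omega>]
  show "\<phi> ` \<omega> \<subseteq> half_line" using sub maps by auto
  fix K :: "real set" assume "compact K \<and> K \<subseteq> half_line"
  then have "finite (\<omega> \<inter> {x \<in> half_line. \<phi> x \<in> K})"
    by (intro configurationsD(2)[OF \<omega>] compact_preimage_half_line cont proper) auto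
  moreover have "\<phi> ` \<omega> \<inter> K \<subseteq> \<phi> ` (\<omega> \<inter> {x \<in> half_line. \<phi> x \<in> K})" using sub by auto
  ultimately show "finite (\<phi> ` \<omega> \<inter> K)" by (meson finite_imageI finite_subset)
qed

text \<open>The image avoids \<open>K\<close> exactly if the configuration avoids the preimage of \<open>K\<close>, which is compact.\<close>

lemma measurable_image_configurations:
  "(\<lambda>\<omega>. \<phi> ` \<omega>) \<in> config_borel half_line \<rightarrow>\<^sub>M config_borel half_line"
proof (rule measurable_sigma_sets[OF sets_config_borel_half_line])
  show "{void_event half_line K |K. compact K \<and> K \<subseteq> half_line} \<subseteq> Pow (configurations half_line)"
    by (auto simp: void_event_def)
  show "(\<lambda>\<omega>. \<phi> ` \<omega>) \<in> space (config_borel half_line) \<rightarrow> configurations half_line"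
    using image_in_configurations by auto
  fix A assume "A \<in> {void_event half_line K |K. compact K \<and> K \<subseteq> half_line}"
  then obtain K where A: "A = void_event half_line K" and K: "compact K" by blast
  have "(\<lambda>\<omega>. \<phi> ` \<omega>) -` A \<inter> space (config_borel half_line)
      = void_event half_line {x \<in> half_line. \<phi> x \<in> K}"
    using image_in_configurations configurationsD(1) by (fastforce simp: A void_event_def)
  then show "(\<lambda>\<omega>. \<phi> ` \<omega>) -` A \<inter> space (config_borel half_line) \<in> sets (config_borel half_line)"
    using sets_void_event[OF _ compact_preimage_half_line[OF cont proper K]] by auto
qed

lemma test_function_compose:
  assumes f: "test_function half_line f"
  shows "test_function half_line (\<lambda>x. f (\<phi> x))"
proof -
  obtain K where K: "compact K" "\<And>x. x \<in> half_line - K \<Longrightarrow> f x = 0"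
    using f unfolding test_function_def by blast
  show ?thesis
    unfolding test_function_def
  proof (intro conjI exI)
    show "continuous_on half_line (\<lambda>x. f (\<phi> x))"
      using f by (intro continuous_on_compose2[OF _ cont maps]) (simp add: test_function_def)
    show "compact {x \<in> half_line. \<phi> x \<in> K}" by (intro compact_preimage_half_line cont proper K)
    show "\<forall>x\<in>half_line - {x \<in> half_line. \<phi> x \<in> K}. f (\<phi> x) = 0"
      using K(2) maps by auto
  qed auto
qed

lemma integral_config_measure_image:
  assumes \<omega>: "\<omega> \<in> configurations half_line" and f: "test_function half_line f"
  shows "(\<integral>x. f x \<partial>config_measure half_line (\<phi> ` \<omega>)) = (\<integral>x. f (\<phi> x) \<partial>config_measure half_line \<omega>)"
proof -
  note sub = configurationsD(1)[OF \<omega>]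
  have \<phi>: "\<phi> \<in> restrict_space borel half_line \<rightarrow>\<^sub>M restrict_space borel half_line"
    by (intro measurable_restrict_borel_continuous_on cont maps)
  have sets_conf: "sets (config_measure half_line \<omega>) = sets (restrict_space borel half_line)"
    by (simp add: config_measure_def)
  have "\<phi> \<in> config_measure half_line \<omega> \<rightarrow>\<^sub>M restrict_space borel half_line"
    using \<phi> by (simp add: measurable_cong_sets[OF sets_conf refl])
  from integral_distr[OF this test_function_measurable[OF f]] show ?thesis
    unfolding config_measure_image[OF sub inj_on_subset[OF inj sub] \<phi>] .
qed

text \<open>The mapping property of Poisson measures. In the Laplace functional, moving the configuration
  amounts to replacing \<open>f\<close> by \<open>f \<circ> \<phi>\<close>, and this moves the intensity.\<close>

lemma poisson_image_eq:
  assumes P: "poisson_measure half_line \<sigma> P" and Q: "poisson_measure half_line \<tau> Q"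
    and \<sigma>: "sets \<sigma> = sets (restrict_space borel half_line)"
    and \<tau>: "\<tau> = distr \<sigma> (restrict_space borel half_line) \<phi>"
  shows "distr P Q (\<lambda>\<omega>. \<phi> ` \<omega>) = Q"
proof (rule law_eq_if_laplace_eq)
  note P' = poisson_measureD[OF P] and Q' = poisson_measureD[OF Q]
  have meas: "(\<lambda>\<omega>. \<phi> ` \<omega>) \<in> P \<rightarrow>\<^sub>M Q"
    using measurable_image_configurations by (simp add: measurable_cong_sets[OF P'(2) Q'(2)])
  show "prob_space (distr P Q (\<lambda>\<omega>. \<phi> ` \<omega>))" by (rule prob_space.prob_space_distr[OF P'(1) meas])
  show "sets (distr P Q (\<lambda>\<omega>. \<phi> ` \<omega>)) = sets (config_borel half_line)" by (simp add: Q')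
  show "prob_space Q" "sets Q = sets (config_borel half_line)" by (rule Q')+
  fix f :: "real \<Rightarrow> real" assume f: "test_function half_line f"
  note fm[measurable] = test_function_measurable[OF f]
  have "(\<lambda>\<omega>. \<integral>x. f x \<partial>config_measure half_line \<omega>) \<in> borel_measurable Q"
    using measurable_integral_config_measure[OF f] by (simp add: measurable_cong_sets[OF Q'(2) refl])
  from integral_distr[OF meas measurable_compose[OF this borel_measurable_exp]]
  have "(\<integral>\<omega>. exp (\<integral>x. f x \<partial>config_measure half_line \<omega>) \<partial>distr P Q (\<lambda>\<omega>. \<phi> ` \<omega>))
      = (\<integral>\<omega>. exp (\<integral>x. f x \<partial>config_measure half_line (\<phi> ` \<omega>)) \<partial>P)"
    .
  also have "\<dots> = (\<integral>\<omega>. exp (\<integral>x. f (\<phi> x) \<partial>config_measure half_line \<omega>) \<partial>P)"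
    by (intro Bochner_Integration.integral_cong) (auto simp: P'(3) integral_config_measure_image[OF _ f])
  also have "\<dots> = exp (\<integral>x. (exp (f (\<phi> x)) - 1) \<partial>\<sigma>)"
    by (rule P'(4)[OF test_function_compose[OF f]])
  also have "(\<integral>x. (exp (f (\<phi> x)) - 1) \<partial>\<sigma>) = (\<integral>x. (exp (f x) - 1) \<partial>\<tau>)"
    unfolding \<tau>
    using measurable_restrict_borel_continuous_on[OF cont maps]
    by (intro integral_distr[symmetric]) (simp_all add: measurable_cong_sets[OF \<sigma> refl])
  also have "exp \<dots> = (\<integral>\<omega>. exp (\<integral>x. f x \<partial>config_measure half_line \<omega>) \<partial>Q)"
    by (rule Q'(4)[OF f, symmetric])
  finally show "(\<integral>\<omega>. exp (\<integral>x. f x \<partial>config_measure half_line \<omega>) \<partial>distr P Q (\<lambda>\<omega>. \<phi> ` \<omega>))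
      = (\<integral>\<omega>. exp (\<integral>x. f x \<partial>config_measure half_line \<omega>) \<partial>Q)" .
qed

end

section \<open>The substitution \<open>x + U x\<close>\<close>

lemma nn_integral_half_lebesgue_Icc:
  assumes "\<And>x. x \<in> {0..b} \<Longrightarrow> 0 \<le> f x" and "(f has_integral I) {0..b}"
  shows "(\<integral>\<^sup>+x. ennreal (f x) * indicator {0..b} x \<partial>half_lebesgue) = ennreal I"
proof -
  have "(\<integral>\<^sup>+x. ennreal (f x) * indicator {0..b} x \<partial>half_lebesgue)
      = (\<integral>\<^sup>+x. ennreal (f x) * indicator {0..b} x \<partial>lborel)"
    by (subst nn_integral_restrict_space) (auto intro!: nn_integral_cong simp: indicator_def)
  also have "\<dots> = ennreal I" by (rule nn_integral_has_integral_lebesgue'[OF assms])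
  finally show ?thesis .
qed

lemma sets_half_lebesgue: "sets half_lebesgue = sets (restrict_space borel half_line)"
  by (simp add: sets_restrict_space)

text \<open>Substitution \<open>y = \<phi> x\<close>. Both measures give \<open>{0..a}\<close> the mass \<open>a\<close>: the preimage of this interval is
  \<open>{0..c}\<close> with \<open>\<phi> c = a\<close>, and \<open>\<phi>'\<close> integrates to \<open>\<phi> c - \<phi> 0\<close> over it.\<close>

lemma distr_density_derivative:
  fixes \<phi> \<phi>' :: "real \<Rightarrow> real"
  assumes deriv: "\<And>x. x \<in> half_line \<Longrightarrow> (\<phi> has_real_derivative \<phi>' x) (at x within half_line)"
    and cont': "continuous_on half_line \<phi>'"
    and nonneg: "\<And>x. x \<in> half_line \<Longrightarrow> 0 \<le> \<phi>' x"
    and mono: "strict_mono_on half_line \<phi>"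
    and "\<phi> 0 = 0" and proper: "filterlim \<phi> at_top at_top"
  shows "distr (density half_lebesgue (\<lambda>x. ennreal (\<phi>' x))) (restrict_space borel half_line) \<phi> = half_lebesgue"
    (is "distr ?\<sigma> ?B \<phi> = _")
proof -
  have cont: "continuous_on half_line \<phi>"
    using deriv by (auto intro!: DERIV_continuous_on)
  have maps: "\<phi> ` half_line \<subseteq> half_line"
    using mono_onD[OF strict_mono_on_imp_mono_on[OF mono], of 0] \<open>\<phi> 0 = 0\<close> by auto
  have \<sigma>: "sets ?\<sigma> = sets ?B" by (simp add: sets_half_lebesgue)
  have \<phi>_meas: "\<phi> \<in> ?\<sigma> \<rightarrow>\<^sub>M ?B"
    using measurable_restrict_borel_continuous_on[OF cont maps] by (simp add: measurable_cong_sets[OF \<sigma> refl])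
  have id_meas: "(\<lambda>x. x) \<in> ?B \<rightarrow>\<^sub>M borel" by (rule measurable_restrict_space1) simp
  have dens_meas: "(\<lambda>x. ennreal (\<phi>' x)) \<in> borel_measurable half_lebesgue"
    using borel_measurable_continuous_on_restrict[OF cont']
    by (simp add: measurable_cong_sets[OF sets_half_lebesgue refl])
  have emeasure: "emeasure ?\<sigma> {0..b} = ennreal (\<phi> b)" if "0 \<le> b" for b
  proof -
    have "(\<phi>' has_integral (\<phi> b - \<phi> 0)) {0..b}"
    proof (rule fundamental_theorem_of_calculus[OF that])
      fix x assume "x \<in> {0..b}"
      then have "(\<phi> has_real_derivative \<phi>' x) (at x within {0..b})"
        by (intro DERIV_subset[OF deriv]) auto
      then show "(\<phi> has_vector_derivative \<phi>' x) (at x within {0..b})"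
        by (simp add: has_real_derivative_iff_has_vector_derivative)
    qed
    moreover have "{0..b} \<in> sets half_lebesgue" by (auto simp: sets_restrict_space)
    ultimately show ?thesis
      using nn_integral_half_lebesgue_Icc[of b \<phi>' "\<phi> b - \<phi> 0"] nonneg \<open>\<phi> 0 = 0\<close>
      by (subst emeasure_density[OF dens_meas]) auto
  qed
  \<comment> \<open>The comparison is made on the whole line, whose Borel sets are generated by the sets \<open>{..a}\<close>.\<close>
  have "distr (distr ?\<sigma> ?B \<phi>) borel (\<lambda>x. x) = distr half_lebesgue borel (\<lambda>x. x)"
  proof (rule measure_eqI_generator_eq[where A = "\<lambda>n. {..real n}" and \<Omega> = UNIV])
    let ?M = "distr (distr ?\<sigma> ?B \<phi>) borel (\<lambda>x. x)" and ?N = "distr half_lebesgue borel (\<lambda>x. x)"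
    show "Int_stable (range (\<lambda>a::real. {..a}))" by (auto simp: Int_stable_def)
    show "sets ?M = sigma_sets UNIV (range (\<lambda>a. {..a}))" "sets ?N = sigma_sets UNIV (range (\<lambda>a. {..a}))"
      by (simp_all add: borel_eq_atMost)
    have N: "emeasure ?N {..a} = ennreal a" for a :: real
    proof -
      have "emeasure ?N {..a} = emeasure half_lebesgue ({..a} \<inter> half_line)"
        using id_meas by (subst emeasure_distr)
          (auto simp: measurable_cong_sets[OF sets_half_lebesgue refl] space_restrict_space)
      also have "\<dots> = emeasure lborel {0..a}"
        by (subst emeasure_restrict_space) (auto intro!: arg_cong[where f = "emeasure lborel"])
      also have "\<dots> = ennreal a" by (cases "0 \<le> a") (auto simp: ennreal_neg)
      finally show ?thesis .
    qed
    have M: "emeasure ?M {..a} = ennreal a" for a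
    proof -
      have "emeasure ?M {..a} = emeasure ?\<sigma> {x \<in> half_line. \<phi> x \<le> a}"
        using id_meas \<phi>_meas
        by (subst distr_distr[OF _ \<phi>_meas], simp, subst emeasure_distr)
          (auto intro!: arg_cong[where f = "emeasure ?\<sigma>"] simp: space_restrict_space)
      also have "\<dots> = ennreal a"
      proof (cases "0 \<le> a")
        case True
        obtain b where b: "0 \<le> b" "a \<le> \<phi> b"
          using proper unfolding filterlim_at_top eventually_at_top_linorder by (metis linear)
        obtain c where c: "0 \<le> c" "\<phi> c = a"
          using IVT'[of \<phi> 0 a b] True b continuous_on_subset[OF cont, of "{0..b}"] \<open>\<phi> 0 = 0\<close> by auto
        have "{x \<in> half_line. \<phi> x \<le> a} = {0..c}"
          using strict_mono_on_less_eq[OF mono, of _ c] c by auto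
        then show ?thesis using emeasure[OF c(1)] c by simp
      next
        case False
        then have "{x \<in> half_line. \<phi> x \<le> a} = {}" using maps by force
        then show ?thesis using False by (simp only: emeasure_empty) (simp add: ennreal_neg)
      qed
      finally show ?thesis .
    qed
    show "emeasure ?M A = emeasure ?N A" if "A \<in> range (\<lambda>a. {..a})" for A
      using that M N by auto
    show "emeasure ?M {..real n} \<noteq> \<infinity>" for n unfolding M by simp
    show "(\<Union>n. {..real n}) = UNIV" using real_arch_simple by auto
  qed auto
  then have eq: "emeasure (distr (distr ?\<sigma> ?B \<phi>) borel (\<lambda>x. x)) A
      = emeasure (distr half_lebesgue borel (\<lambda>x. x)) A" for A by simp
  show ?thesis
  proof (rule measure_eqI)
    show "sets (distr ?\<sigma> ?B \<phi>) = sets half_lebesgue" by (simp add: sets_half_lebesgue)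
    fix A assume "A \<in> sets (distr ?\<sigma> ?B \<phi>)"
    then have A: "A \<subseteq> half_line" "A \<in> sets borel" by (auto simp: sets_restrict_space_iff)
    have "emeasure (distr (distr ?\<sigma> ?B \<phi>) borel (\<lambda>x. x)) A = emeasure (distr ?\<sigma> ?B \<phi>) A"
      using A id_meas by (subst emeasure_distr) (auto simp: space_restrict_space Int_absorb2)
    moreover have "emeasure (distr half_lebesgue borel (\<lambda>x. x)) A = emeasure half_lebesgue A"
      using A id_meas by (subst emeasure_distr)
        (auto simp: space_restrict_space Int_absorb2 measurable_cong_sets[OF sets_half_lebesgue refl])
    ultimately show "emeasure (distr ?\<sigma> ?B \<phi>) A = emeasure half_lebesgue A" using eq[of A] by simp
  qed
qed

text \<open>The term \<open>U\<^sup>2 U'\<close> has the antiderivative \<open>U\<^sup>3 / 3\<close>, which is \<open>0\<close> at \<open>0\<close> and tends to \<open>0\<close>. Its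
  integrability is a consequence of the estimate, so the integrals are first taken up to \<open>n\<close>.\<close>

lemma nn_integral_square_times_one_plus_derivative:
  fixes U U' :: "real \<Rightarrow> real"
  assumes deriv: "\<And>x. x \<in> half_line \<Longrightarrow> (U has_real_derivative U' x) (at x within half_line)"
    and cont': "continuous_on half_line U'"
    and lim: "(U \<longlongrightarrow> 0) at_top" and "U 0 = 0"
    and int: "integrable half_lebesgue (\<lambda>x. (U x)\<^sup>2)"
    and gt: "\<And>x. x \<in> half_line \<Longrightarrow> U' x > -1"
  shows "(\<integral>\<^sup>+x. ennreal ((U x)\<^sup>2 * (1 + U' x)) \<partial>half_lebesgue) \<le> ennreal (\<integral>x. (U x)\<^sup>2 \<partial>half_lebesgue)"
proof -
  define C where "C = (\<integral>x. (U x)\<^sup>2 \<partial>half_lebesgue)"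
  have cont: "continuous_on half_line U" using deriv by (auto intro!: DERIV_continuous_on)
  have nonneg: "0 \<le> (U x)\<^sup>2 * (1 + U' x)" if "x \<in> half_line" for x
    using gt[OF that] by simp
  let ?J = "\<lambda>n. \<integral>\<^sup>+x. ennreal ((U x)\<^sup>2 * (1 + U' x)) * indicator {0..real n} x \<partial>half_lebesgue"
  have le: "?J n \<le> ennreal (C + (U (real n))^3 / 3)" for n
  proof -
    define I where "I = integral {0..real n} (\<lambda>x. (U x)\<^sup>2)"
    have "continuous_on {0..real n} (\<lambda>x. (U x)\<^sup>2)"
      by (intro continuous_intros continuous_on_subset[OF cont]) auto
    then have I: "((\<lambda>x. (U x)\<^sup>2) has_integral I) {0..real n}"
      unfolding I_def by (intro integrable_integral integrable_continuous_interval)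
    have "((\<lambda>x. (U x)\<^sup>2 * U' x) has_integral ((U (real n))^3 / 3 - (U 0)^3 / 3)) {0..real n}"
    proof (rule fundamental_theorem_of_calculus)
      fix x assume "x \<in> {0..real n}"
      then have "(U has_real_derivative U' x) (at x within {0..real n})"
        by (intro DERIV_subset[OF deriv]) auto
      then have "((\<lambda>x. (U x)^3 / 3) has_real_derivative (U x)\<^sup>2 * U' x) (at x within {0..real n})"
        by (auto intro!: derivative_eq_intros)
      then show "((\<lambda>x. (U x)^3 / 3) has_vector_derivative (U x)\<^sup>2 * U' x) (at x within {0..real n})"
        by (simp add: has_real_derivative_iff_has_vector_derivative)
    qed simp
    from has_integral_add[OF I this] \<open>U 0 = 0\<close>
    have "((\<lambda>x. (U x)\<^sup>2 * (1 + U' x)) has_integral (I + (U (real n))^3 / 3)) {0..real n}"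
      by (simp add: algebra_simps)
    then have J: "?J n = ennreal (I + (U (real n))^3 / 3)"
      using nonneg by (intro nn_integral_half_lebesgue_Icc) auto
    have "ennreal I = (\<integral>\<^sup>+x. ennreal ((U x)\<^sup>2) * indicator {0..real n} x \<partial>half_lebesgue)"
      using I by (intro nn_integral_half_lebesgue_Icc[symmetric]) auto
    also have "\<dots> \<le> (\<integral>\<^sup>+x. ennreal ((U x)\<^sup>2) \<partial>half_lebesgue)"
      by (intro nn_integral_mono) (auto simp: indicator_def)
    also have "\<dots> = ennreal C"
      unfolding C_def using int by (intro nn_integral_eq_integral) auto
    finally have "I \<le> C" by (simp add: C_def)
    then show ?thesis unfolding J by (intro ennreal_leI) simp
  qed
  have meas: "(\<lambda>x. ennreal ((U x)\<^sup>2 * (1 + U' x))) \<in> borel_measurable half_lebesgue"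
    using borel_measurable_continuous_on_restrict[of half_line "\<lambda>x. (U x)\<^sup>2 * (1 + U' x)"] cont cont'
    by (simp add: measurable_cong_sets[OF sets_half_lebesgue refl] continuous_intros)
  have ind: "(indicator {0..real n} :: real \<Rightarrow> ennreal) \<in> borel_measurable half_lebesgue" for n
    by (intro measurable_restrict_space1) simp
  have inc: "incseq ?J"
    unfolding incseq_def by (auto intro!: nn_integral_mono simp: indicator_def)
  have "(\<integral>\<^sup>+x. ennreal ((U x)\<^sup>2 * (1 + U' x)) \<partial>half_lebesgue)
      = (\<integral>\<^sup>+x. (SUP n. ennreal ((U x)\<^sup>2 * (1 + U' x)) * indicator {0..real n} x) \<partial>half_lebesgue)"
  proof (rule nn_integral_cong)
    fix x :: real assume "x \<in> space half_lebesgue"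
    then have "0 \<le> x" by (simp add: space_restrict_space)
    obtain n where n: "x \<le> real n" using real_arch_simple by blast
    show "ennreal ((U x)\<^sup>2 * (1 + U' x)) = (SUP n. ennreal ((U x)\<^sup>2 * (1 + U' x)) * indicator {0..real n} x)"
    proof (rule antisym)
      show "ennreal ((U x)\<^sup>2 * (1 + U' x)) \<le> (SUP n. ennreal ((U x)\<^sup>2 * (1 + U' x)) * indicator {0..real n} x)"
        using n \<open>0 \<le> x\<close> by (intro SUP_upper2[of n]) auto
    qed (auto intro!: SUP_least simp: indicator_def)
  qed
  also have "\<dots> = (SUP n. ?J n)"
  proof (rule nn_integral_monotone_convergence_SUP)
    show "(\<lambda>x. ennreal ((U x)\<^sup>2 * (1 + U' x)) * indicator {0..real n} x) \<in> borel_measurable half_lebesgue"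
      for n by (rule borel_measurable_times_ennreal[OF meas ind])
  qed (auto simp: incseq_def le_fun_def indicator_def)
  also have "\<dots> \<le> ennreal C"
  proof (rule LIMSEQ_le[OF LIMSEQ_SUP[OF inc]])
    have "(\<lambda>n. U (real n)) \<longlonglongrightarrow> 0"
      by (rule filterlim_compose[OF lim filterlim_real_sequentially])
    then have "(\<lambda>n. C + (U (real n))^3 / 3) \<longlonglongrightarrow> C + 0^3 / 3"
      by (intro tendsto_intros) auto
    then show "(\<lambda>n. ennreal (C + (U (real n))^3 / 3)) \<longlonglongrightarrow> ennreal C"
      by (intro tendsto_ennrealI) simp
    show "\<exists>N. \<forall>n\<ge>N. ?J n \<le> ennreal (C + (U (real n))^3 / 3)" using le by blast
  qed
  finally show ?thesis by (simp add: C_def)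
qed

section \<open>The bound on the Rubinstein distance\<close>

theorem proposition4p4:
  fixes U U' :: "real \<Rightarrow> real" and \<mu> \<nu> :: "real set measure"
  assumes "\<And>x. x \<in> half_line \<Longrightarrow> (U has_real_derivative U' x) (at x within half_line)"
    and "continuous_on half_line U'"
    and "(U \<longlongrightarrow> 0) at_top"
    and "U 0 = 0"
    and "integrable half_lebesgue (\<lambda>x. (U x)\<^sup>2)"
    and "\<And>x. x \<in> half_line \<Longrightarrow> U' x > -1"
    and "poisson_measure half_line half_lebesgue \<mu>"
    and "poisson_measure half_line (density half_lebesgue (\<lambda>x. ennreal (1 + U' x))) \<nu>"
  shows "rubinstein_dist (wasserstein_dist half_line) \<mu> \<nu> \<le> ennreal (L2_norm half_lebesgue U)"
proof -
  note \<mu> = poisson_measureD[OF assms(7)] and \<nu> = poisson_measureD[OF assms(8)]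
  let ?\<sigma> = "density half_lebesgue (\<lambda>x. ennreal (1 + U' x))"
  define C where "C = (\<integral>x. (U x)\<^sup>2 \<partial>half_lebesgue)"
  have "0 \<le> C" unfolding C_def by (intro integral_nonneg_AE) auto
  define \<phi> where "\<phi> x = x + U x" for x
  have deriv: "(\<phi> has_real_derivative 1 + U' x) (at x within half_line)" if "x \<in> half_line" for x
    unfolding \<phi>_def using assms(1)[OF that] by (auto intro!: derivative_eq_intros)
  have cont: "continuous_on half_line \<phi>" using deriv by (auto intro!: DERIV_continuous_on)
  have contU: "continuous_on half_line U" using assms(1) by (auto intro!: DERIV_continuous_on)
  have mono: "strict_mono_on half_line \<phi>"
  proof (rule strict_mono_onI)
    fix x y :: real assume xy: "x \<in> half_line" "y \<in> half_line" "x < y"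
    have "\<exists>z\<in>{x<..<y}. \<phi> y - \<phi> x = (1 + U' z) * (y - x)"
    proof (rule mvt_simple[OF \<open>x < y\<close>])
      fix z assume z: "x \<le> z" "z \<le> y"
      have "(\<phi> has_real_derivative 1 + U' z) (at z within {x..y})"
        using xy z by (intro DERIV_subset[OF deriv]) auto
      then show "(\<phi> has_derivative (\<lambda>h. (1 + U' z) * h)) (at z within {x..y})"
        by (simp add: has_field_derivative_def)
    qed
    then obtain z where z: "z \<in> {x<..<y}" and "\<phi> y - \<phi> x = (1 + U' z) * (y - x)" by blast
    moreover have "z \<in> half_line" using z xy(1) by auto
    moreover have "0 < (1 + U' z) * (y - x)" using assms(6)[OF calculation(3)] xy by simp
    ultimately show "\<phi> x < \<phi> y" by simp
  qed
  have inj: "inj_on \<phi> half_line" by (rule strict_mono_on_imp_inj_on[OF mono])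
  have "\<phi> 0 = 0" by (simp add: \<phi>_def assms(4))
  have maps: "\<phi> ` half_line \<subseteq> half_line"
    using mono_onD[OF strict_mono_on_imp_mono_on[OF mono], of 0] \<open>\<phi> 0 = 0\<close> by auto
  have proper: "filterlim \<phi> at_top at_top"
  proof -
    have "filterlim (\<lambda>x. U x + x) at_top at_top"
      by (rule filterlim_tendsto_add_at_top[OF assms(3) filterlim_ident])
    then show ?thesis by (simp add: \<phi>_def[abs_def] add.commute)
  qed
  have \<sigma>: "sets ?\<sigma> = sets (restrict_space borel half_line)" by (simp add: sets_half_lebesgue)
  have push: "distr ?\<sigma> (restrict_space borel half_line) \<phi> = half_lebesgue"
  proof (rule distr_density_derivative[OF deriv _ _ mono \<open>\<phi> 0 = 0\<close> proper])
    show "continuous_on half_line (\<lambda>x. 1 + U' x)" by (intro continuous_intros assms(2))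
    show "0 \<le> 1 + U' x" if "x \<in> half_line" for x using assms(6)[OF that] by simp
  qed
  have image: "distr \<nu> \<mu> (\<lambda>\<omega>. \<phi> ` \<omega>) = \<mu>"
    by (rule poisson_image_eq[OF cont proper maps inj assms(8,7) \<sigma> push[symmetric]])

  have meas: "(\<lambda>\<omega>. \<phi> ` \<omega>) \<in> \<nu> \<rightarrow>\<^sub>M \<mu>"
    using measurable_image_configurations[OF cont proper maps inj]
    by (simp add: measurable_cong_sets[OF \<nu>(2) \<mu>(2)])
  have pair_meas: "(\<lambda>\<omega>. (\<phi> ` \<omega>, \<omega>)) \<in> \<nu> \<rightarrow>\<^sub>M \<mu> \<Otimes>\<^sub>M \<nu>"
    using meas by (intro measurable_Pair) auto
  define \<gamma> where "\<gamma> = distr \<nu> (\<mu> \<Otimes>\<^sub>M \<nu>) (\<lambda>\<omega>. (\<phi> ` \<omega>, \<omega>))"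
  have \<gamma>: "\<gamma> \<in> measure_couplings \<mu> \<nu>"
    unfolding measure_couplings_def
  proof (intro CollectI conjI)
    show "prob_space \<gamma>" unfolding \<gamma>_def by (rule prob_space.prob_space_distr[OF \<nu>(1) pair_meas])
    show "sets \<gamma> = sets (\<mu> \<Otimes>\<^sub>M \<nu>)" by (simp add: \<gamma>_def)
    show "distr \<gamma> \<mu> fst = \<mu>"
      unfolding \<gamma>_def using image by (simp add: distr_distr[OF measurable_fst pair_meas] comp_def)
    show "distr \<gamma> \<nu> snd = \<nu>"
      unfolding \<gamma>_def by (simp add: distr_distr[OF measurable_snd pair_meas] comp_def)
  qed

  define Z where "Z \<omega> = (\<integral>\<^sup>+x. ennreal ((U x)\<^sup>2) \<partial>config_measure half_line \<omega>)" for \<omega>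
  have contU2: "continuous_on half_line (\<lambda>x. (U x)\<^sup>2)" by (intro continuous_intros contU)
  have Z_meas: "Z \<in> borel_measurable \<nu>"
    using measurable_nn_integral_config_measure[OF contU2] unfolding Z_def
    by (simp add: measurable_cong_sets[OF \<nu>(2) refl])
  have "(\<integral>\<^sup>+\<omega>. Z \<omega> \<partial>\<nu>) \<le> (\<integral>\<^sup>+x. ennreal ((U x)\<^sup>2) \<partial>?\<sigma>)"
    unfolding Z_def by (rule poisson_campbell[OF contU2 _ assms(8) \<sigma>]) simp
  also have "\<dots> = (\<integral>\<^sup>+x. ennreal ((U x)\<^sup>2 * (1 + U' x)) \<partial>half_lebesgue)"
  proof -
    have "(\<lambda>x. ennreal (1 + U' x)) \<in> borel_measurable half_lebesgue"
      "(\<lambda>x. ennreal ((U x)\<^sup>2)) \<in> borel_measurable half_lebesgue"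
      using borel_measurable_continuous_on_restrict[OF contU2]
        borel_measurable_continuous_on_restrict[OF assms(2)]
      by (simp_all add: measurable_cong_sets[OF sets_half_lebesgue refl])
    then show ?thesis
      by (simp add: nn_integral_density ennreal_mult'' mult.commute)
  qed
  also have "\<dots> \<le> ennreal C"
    unfolding C_def by (rule nn_integral_square_times_one_plus_derivative[OF assms(1-6)])
  finally have Z_le: "(\<integral>\<^sup>+\<omega>. Z \<omega> \<partial>\<nu>) \<le> ennreal C" .

  \<comment> \<open>Every \<open>a\<close> above \<open>sqrt C\<close> is used in place of \<open>sqrt C\<close>, as the latter may be \<open>0\<close>.\<close>
  have bound: "rubinstein_dist (wasserstein_dist half_line) \<mu> \<nu> \<le> ennreal a" if a: "sqrt C < a" for a
  proof -
    have "0 < a" using a \<open>0 \<le> C\<close> by (meson le_less_trans real_sqrt_ge_zero)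
    have "C \<le> a\<^sup>2" using a \<open>0 < a\<close> by (simp add: real_sqrt_le_iff' sqrt_le_D less_imp_le)
    have "rubinstein_dist (wasserstein_dist half_line) \<mu> \<nu>
        \<le> (\<integral>\<^sup>+z. wasserstein_dist half_line (fst z) (snd z) \<partial>\<gamma>)"
      unfolding rubinstein_dist_def by (rule INF_lower[OF \<gamma>])
    also have "\<dots> \<le> (\<integral>\<^sup>+\<omega>. wasserstein_dist half_line (\<phi> ` \<omega>) \<omega> \<partial>\<nu>)"
      unfolding \<gamma>_def by (rule order_trans[OF nn_integral_distr_le[OF pair_meas]]) simp
    also have "\<dots> \<le> (\<integral>\<^sup>+\<omega>. ennreal (1 / (2 * a)) * Z \<omega> + ennreal (a / 2) \<partial>\<nu>)"
    proof (rule nn_integral_mono)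
      fix \<omega> assume "\<omega> \<in> space \<nu>"
      then have "wasserstein_dist half_line (\<phi> ` \<omega>) \<omega>
          \<le> ennreal_sqrt (\<integral>\<^sup>+x. ennreal ((dist (\<phi> x) x)\<^sup>2) \<partial>config_measure half_line \<omega>)"
        by (intro wasserstein_dist_image_le inj maps cont) (simp add: \<nu>(3))
      also have "\<dots> = ennreal_sqrt (Z \<omega>)" by (simp add: Z_def \<phi>_def dist_real_def)
      also have "\<dots> \<le> ennreal (1 / (2 * a)) * Z \<omega> + ennreal (a / 2)"
        by (rule ennreal_sqrt_le[OF \<open>0 < a\<close>])
      finally show "wasserstein_dist half_line (\<phi> ` \<omega>) \<omega> \<le> ennreal (1 / (2 * a)) * Z \<omega> + ennreal (a / 2)" .
    qed
    also have "\<dots> = ennreal (1 / (2 * a)) * (\<integral>\<^sup>+\<omega>. Z \<omega> \<partial>\<nu>) + ennreal (a / 2)"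
      using Z_meas prob_space.emeasure_space_1[OF \<nu>(1)] by (simp add: nn_integral_add nn_integral_cmult)
    also have "\<dots> \<le> ennreal (1 / (2 * a)) * ennreal C + ennreal (a / 2)"
      by (intro add_right_mono mult_left_mono Z_le) simp
    also have "\<dots> = ennreal (1 / (2 * a) * C + a / 2)"
      using \<open>0 \<le> C\<close> \<open>0 < a\<close> by (simp add: ennreal_mult[symmetric])
    also have "\<dots> \<le> ennreal a"
      using \<open>C \<le> a\<^sup>2\<close> \<open>0 < a\<close> by (intro ennreal_leI) (simp add: field_simps power2_eq_square)
    finally show ?thesis .
  qed
  have "rubinstein_dist (wasserstein_dist half_line) \<mu> \<nu> \<le> ennreal (sqrt C)"
  proof (rule ennreal_le_epsilon)
    fix e :: real assume "0 < e"
    then show "rubinstein_dist (wasserstein_dist half_line) \<mu> \<nu> \<le> ennreal (sqrt C) + ennreal e"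
      using bound[of "sqrt C + e"] \<open>0 \<le> C\<close> by simp
  qed
  then show ?thesis by (simp add: L2_norm_def C_def)
qed

end
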